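(* Let $\varphi(z)=\sum_{n=0}^{\infty}a_nz^n$ be a real entire function all of whose zeros are real. Suppose there exists $n_0\in\mathbb{N}$ such that $a_{n-1}a_{n+1}\le 0$ for all $n>n_0$, and that $$0<\limsup_{n\to\infty} n\,|a_n|^{2/n}<\infty .$$ Then $\varphi\in\mathcal{LP}^a$.
   Context: A real entire function $\varphi$ belongs to the Laguerre–Pólya class $\mathcal{LP}$ if it can be written as $$\varphi(z)=cz^m e^{az^2+bz}\prod_{k=1}^{\omega}(1-z/x_k)e^{\lambda z/x_k},\quad 0\le\omega\le\infty,$$ with $m$ a nonnegative integer, $c,a,b\in\mathbb{R}$, $a\le 0$, $\lambda\in\{0,1\}$, $x_k\in\mathbb{R}\setminus\{0\}$ and $\sum_k|x_k|^{-\lambda-1}<\infty$ (empty product $=1$). The subclass $\mathcal{LP}^a$ consists of those $\varphi\in\mathcal{LP}$ for which the constant $a$ in this representation is nonzero (hence $a<0$). *)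

theory Defs
  imports "HOL-Analysis.Analysis"
begin

text \<open>Laguerre--Polya representation with Gaussian parameter A:
  phi z = c z^m exp(A z^2 + b z) prod_{k in I} (1 - z/x_k) exp(lam z/x_k),
  where the index set I is {..<N} (omega = N finite) or UNIV (omega = infinity);
  the infinite product is understood as the limit of the partial products
  in the natural order of the indices.\<close>
definition LP_repr :: "(complex \<Rightarrow> complex) \<Rightarrow> real \<Rightarrow> bool" where
  "LP_repr phi A \<longleftrightarrow>
     (\<exists>(c::real) (m::nat) (b::real) (lam::real) (x::nat \<Rightarrow> real) (I::nat set).
        (I = UNIV \<or> (\<exists>N. I = {..<N})) \<and> lam \<in> {0, 1} \<and>
        (\<forall>k\<in>I. x k \<noteq> 0) \<and>
        (\<lambda>k. \<bar>x k\<bar> powr (- lam - 1)) summable_on I \<and>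
        (\<forall>z::complex.
           (\<lambda>n. of_real c * z ^ m * exp (of_real A * z\<^sup>2 + of_real b * z) *
                 (\<Prod>k\<in>I \<inter> {..<n}. (1 - z / of_real (x k)) * exp (of_real lam * z / of_real (x k))))
           \<longlonglongrightarrow> phi z))"

definition LP :: "(complex \<Rightarrow> complex) \<Rightarrow> bool" where
  "LP phi \<longleftrightarrow> (\<exists>A \<le> 0. LP_repr phi A)"

definition LPa :: "(complex \<Rightarrow> complex) \<Rightarrow> bool" where
  "LPa phi \<longleftrightarrow> (\<exists>A < 0. LP_repr phi A)"

end

theory Submission
  imports Defs "HOL-Complex_Analysis.Complex_Analysis"
begin

text \<open>
  Write the function as z^m f(z) with f(0) nonzero and divide out the zeros of f one at a time,
  nearest to the origin first, so that f = prod_{k<n} (1 - z/x_k) F_n with F_n zero free on a disc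
  of radius R that tends to infinity. Finite type bounds log |F_n| by O(R^2) there, so by
  Borel--Caratheodory the quadratic Taylor coefficient of log F_n stays bounded and the
  higher-order part tends to 0. That quadratic coefficient is a constant plus
  (1/2) sum_{k<n} x_k^{-2}; since the x_k are real this sum converges, and the partial products
  converge to the Laguerre--Polya form with a real Gaussian parameter A of so far unknown sign.

  The remaining factor has minimal type of order 2. If A = 0, this contradicts the positive type.
  If A > 0, write the even and odd parts as series g(w) = sum b_k w^k in w = z^2.
  Then exp(-A w) g(w) has exponential type 0, and therefore k! b_k A^{-k} is interpolated by
  its Newton series, an entire function of small exponential type. The sign condition gives it a
  zero in every interval [k, k+1], which is too many unless it vanishes at all natural numbers.
\<close>

section \<open>Zero-free functions on discs\<close>

lemma entire_power_series:
  fixes a :: "nat \<Rightarrow> complex"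
  assumes "\<And>z. summable (\<lambda>n. a n * z ^ n)"
  shows holomorphic_entire_power_series: "(\<lambda>z. \<Sum>n. a n * z ^ n) holomorphic_on UNIV"
    and higher_deriv_entire_power_series: "(deriv ^^ n) (\<lambda>z. \<Sum>n. a n * z ^ n) 0 = fact n * a n"
proof -
  have eq: "eval_fps (Abs_fps a) = (\<lambda>z. \<Sum>n. a n * z ^ n)"
    by (simp add: eval_fps_def fun_eq_iff)
  have rad: "fps_conv_radius (Abs_fps a) = \<infinity>"
    unfolding fps_conv_radius_def using assms by (intro conv_radius_inftyI'') simp_all
  show "(\<lambda>z. \<Sum>n. a n * z ^ n) holomorphic_on UNIV"
    using holomorphic_on_eval_fps[of UNIV "Abs_fps a"] rad eq by simp
  show "(deriv ^^ n) (\<lambda>z. \<Sum>n. a n * z ^ n) 0 = fact n * a n"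
    using fps_nth_conv_deriv[of "Abs_fps a" n] rad eq by (simp add: field_simps)
qed

lemma entire_divide_zero:
  assumes "f holomorphic_on UNIV" "f w = 0"
  obtains g where "g holomorphic_on UNIV" "\<And>z. f z = (z - w) * g z"
proof
  show "(\<lambda>z. if z = w then deriv f w else f z / (z - w)) holomorphic_on UNIV"
    by (rule pole_theorem_open_0[OF assms(1)]) (use assms in auto)
qed (use assms in auto)

lemma entire_max_modulus:
  assumes "f holomorphic_on UNIV" "\<And>z. cmod z = R \<Longrightarrow> cmod (f z) \<le> M" "cmod z \<le> R"
  shows "cmod (f z) \<le> M"
proof (cases "R = 0")
  case False
  then have "R > 0" using assms(3) norm_ge_zero[of z] by linarith
  show ?thesis
  proof (rule maximum_modulus_frontier[of f "cball 0 R"])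
    show "f holomorphic_on interior (cball 0 R)"
      using assms(1) holomorphic_on_subset by blast
    show "continuous_on (closure (cball 0 R)) f"
      using assms(1) holomorphic_on_imp_continuous_on continuous_on_subset by blast
  qed (use assms \<open>R > 0\<close> in auto)
qed (use assms in auto)

lemma entire_Cauchy_inequality:
  assumes "f holomorphic_on UNIV" "R > 0" "\<And>z. cmod z = R \<Longrightarrow> cmod (f z) \<le> M"
  shows "cmod ((deriv ^^ n) f 0) \<le> fact n * M / R ^ n"
proof (rule Cauchy_inequality)
  show "f holomorphic_on ball 0 R"
    using assms(1) holomorphic_on_subset by blast
  show "continuous_on (cball 0 R) f"
    using assms(1) holomorphic_on_imp_continuous_on continuous_on_subset by blast
qed (use assms in auto)

text \<open>The Schwarz lemma bounds the Moebius transform \<open>F\<close> of \<open>g\<close> by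
  1/2 on the half disc. There |g| <= (2A + |g|) / 2, which is solved for |g|.\<close>

lemma Borel_Caratheodory_half:
  assumes hol: "g holomorphic_on ball 0 R" and g0: "g 0 = 0"
    and Re: "\<And>z. z \<in> ball 0 R \<Longrightarrow> Re (g z) < A" and z: "cmod z \<le> R / 2" and "R > 0"
  shows "cmod (g z) \<le> 2 * A"
proof -
  have A: "A > 0" using Re[of 0] g0 \<open>R > 0\<close> by simp
  \<comment> \<open>The map w \<mapsto> w / (2A - w) sends the half plane Re w < A into the unit disc.\<close>
  define F where "F = (\<lambda>u. g (of_real R * u) / (of_real (2 * A) - g (of_real R * u)))"
  have in_ball: "of_real R * u \<in> ball 0 R" if "cmod u < 1" for u
    using that \<open>R > 0\<close> by (simp add: norm_mult)
  have nz: "of_real (2 * A) - g (of_real R * u) \<noteq> 0" if "cmod u < 1" for u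
  proof
    assume "of_real (2 * A) - g (of_real R * u) = 0"
    then have "Re (g (of_real R * u)) = 2 * A" by (metis Re_complex_of_real right_minus_eq)
    with Re[OF in_ball[OF that]] A show False by simp
  qed
  have holF: "F holomorphic_on ball 0 1"
  proof -
    have "(g \<circ> (\<lambda>u. of_real R * u)) holomorphic_on ball 0 1"
      by (intro holomorphic_on_compose_gen[OF _ hol] holomorphic_intros) (use in_ball in auto)
    then have "(\<lambda>u. g (of_real R * u)) holomorphic_on ball 0 1" by (simp add: o_def)
    then show ?thesis unfolding F_def by (intro holomorphic_intros) (use nz in auto)
  qed
  have lt: "cmod (F u) < 1" if "cmod u < 1" for u
  proof -
    define w where "w = g (of_real R * u)"
    have "Re w < A" using Re[OF in_ball[OF that]] by (simp add: w_def)
    then have "0 < A * (A - Re w)" using A by simp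
    then have "(Re w)\<^sup>2 < (2 * A - Re w)\<^sup>2" by (simp add: power2_eq_square algebra_simps)
    then have "(cmod w)\<^sup>2 < (cmod (of_real (2 * A) - w))\<^sup>2"
      by (simp add: cmod_power2)
    then have "cmod w < cmod (of_real (2 * A) - w)"
      by (rule power_less_imp_less_base) simp
    then show ?thesis
      using nz[OF that] unfolding F_def w_def[symmetric] by (simp add: norm_divide)
  qed
  define u where "u = z / of_real R"
  have zu: "z = of_real R * u" using \<open>R > 0\<close> by (simp add: u_def)
  have u: "cmod u \<le> 1 / 2" using z \<open>R > 0\<close> by (simp add: u_def norm_divide field_simps)
  have "cmod (F u) \<le> cmod u"
    by (rule Schwarz_Lemma(1)[OF holF _ lt]) (use u g0 in \<open>auto simp: F_def\<close>)
  then have "cmod (F u) \<le> 1 / 2" using u by simp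
  moreover have "g z = F u * (of_real (2 * A) - g z)"
    using nz[of u] u by (simp add: F_def zu)
  ultimately have "cmod (g z) \<le> 1 / 2 * cmod (of_real (2 * A) - g z)"
    by (metis mult_right_mono norm_ge_zero norm_mult)
  also have "cmod (of_real (2 * A) - g z) \<le> 2 * A + cmod (g z)"
    using norm_triangle_ineq4[of "of_real (2 * A)" "g z"] A by simp
  finally show ?thesis by simp
qed

text \<open>This and \<open>log_deriv2\<close> are the first and second derivatives of log f at 0,
  written without a logarithm so that they make sense whenever \<open>f 0\<close> is nonzero,
  whatever the zeros elsewhere.\<close>

definition log_deriv1 :: "(complex \<Rightarrow> complex) \<Rightarrow> complex" where
  "log_deriv1 f = deriv f 0 / f 0"

definition log_deriv2 :: "(complex \<Rightarrow> complex) \<Rightarrow> complex" where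
  "log_deriv2 f = (deriv (deriv f) 0 * f 0 - (deriv f 0)\<^sup>2) / (f 0)\<^sup>2"

text \<open>Logarithms add, and log (1 - z/w) = -z/w - z^2/(2 w^2) - ... For w = 0 the convention
  z/0 = 0 makes both corrections vanish.\<close>

lemma log_deriv_factor:
  assumes hol: "g holomorphic_on UNIV" and g0: "g 0 \<noteq> 0"
    and f: "\<And>z. f z = (1 - z / w) * g z"
  shows log_deriv1_factor: "log_deriv1 f = log_deriv1 g - 1 / w"
    and log_deriv2_factor: "log_deriv2 f = log_deriv2 g - 1 / w\<^sup>2"
proof -
  have dg: "(g has_field_derivative deriv g z) (at z)" for z
    using hol holomorphic_derivI by blast
  have ddg: "(deriv g has_field_derivative deriv (deriv g) z) (at z)" for z
    using hol holomorphic_derivI holomorphic_deriv open_UNIV by blast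
  have dl: "((\<lambda>z. 1 - z / w) has_field_derivative - (1 / w)) (at z)" for z
    by (cases "w = 0") (auto intro!: derivative_eq_intros simp: field_simps)
  have f': "f = (\<lambda>z. (1 - z / w) * g z)" using f by auto
  have df: "deriv f = (\<lambda>z. (1 - z / w) * deriv g z - g z / w)"
    unfolding f' by (intro ext DERIV_imp_deriv)
      (rule DERIV_cong[OF DERIV_mult[OF dl dg]], simp add: field_simps)
  have ddf: "deriv (deriv f) z = (1 - z / w) * deriv (deriv g) z - 2 * deriv g z / w" for z
    unfolding df by (intro DERIV_imp_deriv)
      (rule DERIV_cong[OF DERIV_diff[OF DERIV_mult[OF dl ddg] DERIV_cdivide[OF dg]]], simp add: field_simps)
  have df0: "deriv f 0 = deriv g 0 - g 0 / w" by (simp add: df)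
  have ddf0: "deriv (deriv f) 0 = deriv (deriv g) 0 - 2 * deriv g 0 / w" by (simp add: ddf)
  have f0: "f 0 = g 0" by (simp add: f)
  show "log_deriv1 f = log_deriv1 g - 1 / w"
    using g0 by (simp add: log_deriv1_def df0 f0 diff_divide_distrib)
  show "log_deriv2 f = log_deriv2 g - 1 / w\<^sup>2"
    using g0 unfolding log_deriv2_def df0 ddf0 f0
    by (cases "w = 0") (simp_all add: field_simps power2_eq_square)
qed

text \<open>The bound on |h| bounds the real part of log (h / h 0), Borel-Caratheodory turns this
  into a bound on the modulus, and Cauchy's inequality then controls the second derivative at 0 and
  the third derivative in the Taylor remainder.\<close>

lemma zero_free_estimate:
  assumes hol: "h holomorphic_on ball 0 R" and nz: "\<And>z. z \<in> ball 0 R \<Longrightarrow> h z \<noteq> 0" and "R > 0"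
    and bd: "\<And>z. z \<in> ball 0 R \<Longrightarrow> cmod (h z) < exp A * cmod (h 0)"
  shows zero_free_log_deriv2_le: "cmod (log_deriv2 h) \<le> 16 * A / R\<^sup>2"
    and zero_free_expansion: "cmod z \<le> R / 4 \<Longrightarrow>
      \<exists>e. cmod e \<le> 384 * A * cmod z ^ 3 / R ^ 3 \<and>
          h z = h 0 * exp (log_deriv1 h * z + log_deriv2 h / 2 * z\<^sup>2 + e)"
proof -
  obtain g0 where g0: "g0 holomorphic_on ball 0 R" "\<And>z. z \<in> ball 0 R \<Longrightarrow> h z = exp (g0 z)"
    using contractible_imp_holomorphic_log[OF hol convex_imp_contractible nz] by auto
  define g where "g = (\<lambda>z. g0 z - g0 0)"
  have holg: "g holomorphic_on ball 0 R" unfolding g_def by (intro holomorphic_intros g0)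
  have g_0: "g 0 = 0" by (simp add: g_def)
  have h0: "h 0 \<noteq> 0" using nz \<open>R > 0\<close> by simp
  have hg: "h z = h 0 * exp (g z)" if "z \<in> ball 0 R" for z
    using g0(2)[OF that] g0(2)[of 0] \<open>R > 0\<close> by (simp add: g_def exp_diff)
  have Reg: "Re (g z) < A" if "z \<in> ball 0 R" for z
    using bd[OF that] hg[OF that] h0 by (simp add: norm_mult mult.commute)
  have A: "A > 0" using Reg[of 0] g_0 \<open>R > 0\<close> by simp
  have gle: "cmod (g z) \<le> 2 * A" if "cmod z \<le> R / 2" for z
    using Borel_Caratheodory_half[OF holg g_0 Reg that \<open>R > 0\<close>] .
  have contg: "continuous_on (ball 0 R) g" by (rule holomorphic_on_imp_continuous_on[OF holg])
  \<comment> \<open>The disc about \<open>w\<close> has to lie in the half disc, where |g| <= 2A is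
    known.\<close>
  have cb: "cmod ((deriv ^^ n) g w) \<le> fact n * (2 * A) / r ^ n"
    if "r > 0" "cmod w + r \<le> R / 2" for n w r
  proof (rule Cauchy_inequality)
    have sub: "cball w r \<subseteq> ball 0 R"
    proof
      fix u assume "u \<in> cball w r"
      then have "cmod (w - u) \<le> r" by (simp add: dist_norm)
      then show "u \<in> ball 0 R"
        using that norm_triangle_ineq4[of w "w - u"] \<open>R > 0\<close> by simp
    qed
    show "g holomorphic_on ball w r"
      using holg sub holomorphic_on_subset ball_subset_cball by (meson order_trans)
    show "continuous_on (cball w r) g" using contg sub continuous_on_subset by blast
    fix u assume "cmod (w - u) = r"
    then show "cmod (g u) \<le> 2 * A"
      using that norm_triangle_ineq4[of w "w - u"] by (intro gle) simp
  qed fact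
  have dg: "((deriv ^^ n) g has_field_derivative (deriv ^^ Suc n) g z) (at z)" if "z \<in> ball 0 R" for z n
    using has_field_derivative_higher_deriv[OF holg open_ball that] .
  have dg0: "(g has_field_derivative deriv g z) (at z)" if "z \<in> ball 0 R" for z
    using dg[OF that, of 0] by simp
  have dg1: "(deriv g has_field_derivative deriv (deriv g) z) (at z)" if "z \<in> ball 0 R" for z
    using dg[OF that, of 1] by simp
  have dh: "deriv h z = deriv g z * h z" if z: "z \<in> ball 0 R" for z
  proof -
    have "((\<lambda>z. h 0 * exp (g z)) has_field_derivative deriv g z * h z) (at z)"
      using hg[OF z] by (auto intro!: derivative_eq_intros dg0 z)
    then have "(h has_field_derivative deriv g z * h z) (at z)"
      by (rule has_field_derivative_transform_within_open[of _ _ _ "ball 0 R"])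
        (use z hg in auto)
    then show ?thesis by (rule DERIV_imp_deriv)
  qed
  have z0: "(0::complex) \<in> ball 0 R" using \<open>R > 0\<close> by simp
  have ddh: "deriv (deriv h) 0 = deriv (deriv g) 0 * h 0 + deriv g 0 * deriv h 0"
  proof -
    have "(h has_field_derivative deriv h 0) (at 0)"
      using holomorphic_derivI[OF hol open_ball z0] .
    then have "((\<lambda>z. deriv g z * h z) has_field_derivative
        deriv (deriv g) 0 * h 0 + deriv g 0 * deriv h 0) (at 0)"
      by (auto intro!: derivative_eq_intros dg1 z0)
    then have "(deriv h has_field_derivative
        deriv (deriv g) 0 * h 0 + deriv g 0 * deriv h 0) (at 0)"
      by (rule has_field_derivative_transform_within_open[of _ _ _ "ball 0 R"])
        (use z0 dh in auto)
    then show ?thesis by (rule DERIV_imp_deriv)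
  qed
  have l1: "log_deriv1 h = deriv g 0"
    using dh[OF z0] h0 by (simp add: log_deriv1_def)
  have l2: "log_deriv2 h = deriv (deriv g) 0"
    using dh[OF z0] h0 by (simp add: log_deriv2_def ddh power2_eq_square field_simps)
  show "cmod (log_deriv2 h) \<le> 16 * A / R\<^sup>2"
    using cb[of "R / 2" 0 2] \<open>R > 0\<close> by (simp add: l2 field_simps numeral_2_eq_2)
  show "\<exists>e. cmod e \<le> 384 * A * cmod z ^ 3 / R ^ 3 \<and>
          h z = h 0 * exp (log_deriv1 h * z + log_deriv2 h / 2 * z\<^sup>2 + e)"
    if z: "cmod z \<le> R / 4"
  proof -
    define e where "e = g z - (deriv g 0 * z + deriv (deriv g) 0 / 2 * z\<^sup>2)"
    \<comment> \<open>The third derivative on |z| <= R/4 is at most 3! * 2A / (R/4)^3 = 768 A / R^3;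
      \<open>complex_Taylor\<close> of order 2 divides by \<open>fact 2\<close>, hence 384.\<close>
    have "cmod ((deriv ^^ 0) g z - (\<Sum>i\<le>2. (deriv ^^ i) g 0 * (z - 0) ^ i / fact i))
        \<le> (768 * A / R ^ 3) * cmod (z - 0) ^ Suc 2 / fact 2"
    proof (rule complex_Taylor[of "cball 0 (R / 4)"])
      show "((deriv ^^ i) g has_field_derivative (deriv ^^ Suc i) g x) (at x within cball 0 (R / 4))"
        if "x \<in> cball 0 (R / 4)" "i \<le> 2" for i x
      proof (rule has_field_derivative_at_within, rule dg)
        show "x \<in> ball 0 R" using that \<open>R > 0\<close> by simp
      qed
      show "cmod ((deriv ^^ Suc 2) g x) \<le> 768 * A / R ^ 3" if "x \<in> cball 0 (R / 4)" for x
        using cb[of "R / 4" x 3] that \<open>R > 0\<close>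
        by (simp add: field_simps power3_eq_cube fact_numeral numeral_3_eq_3)
    qed (use z \<open>R > 0\<close> in auto)
    moreover have "(\<Sum>i\<le>2. (deriv ^^ i) g 0 * (z - 0) ^ i / fact i)
        = deriv g 0 * z + deriv (deriv g) 0 / 2 * z\<^sup>2"
      by (simp add: numeral_2_eq_2 g_0)
    ultimately have "cmod e \<le> 384 * A * cmod z ^ 3 / R ^ 3"
      by (simp add: e_def numeral_3_eq_3 numeral_2_eq_2)
    moreover have "h z = h 0 * exp (log_deriv1 h * z + log_deriv2 h / 2 * z\<^sup>2 + e)"
      using hg[of z] z \<open>R > 0\<close> by (simp add: e_def l1 l2)
    ultimately show ?thesis by blast
  qed
qed

section \<open>Dividing out real zeros\<close>

text \<open>
  The value x = 0 encodes that no zero is left: since z/0 = 0, the factor 1 - z/x is then 1,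
  and finitely and infinitely many zeros need no separate treatment.
\<close>

lemma nearest_real_zero:
  assumes hol: "f holomorphic_on UNIV" and f0: "f 0 \<noteq> 0"
    and real_zeros: "\<And>z. f z = 0 \<Longrightarrow> Im z = 0"
  shows "\<exists>g (x::real). g holomorphic_on UNIV \<and> g 0 = f 0 \<and>
    (\<forall>z. f z = (1 - z / of_real x) * g z) \<and>
    (\<forall>z. f z = 0 \<longrightarrow> x \<noteq> 0 \<and> \<bar>x\<bar> \<le> cmod z) \<and> (x \<noteq> 0 \<longrightarrow> f (of_real x) = 0)"
proof (cases "\<exists>z. f z = 0")
  case False
  with hol show ?thesis by (intro exI[of _ f] exI[of _ 0]) auto
next
  case True
  then obtain w0 where w0: "f w0 = 0" by blast
  define Z where "Z = {z. f z = 0}"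
  have "closed Z"
    unfolding Z_def using hol holomorphic_on_imp_continuous_on by (intro closed_Collect_eq) auto
  moreover have "Z \<noteq> {}" using w0 by (auto simp: Z_def)
  ultimately obtain w where w: "w \<in> Z" "\<And>z. z \<in> Z \<Longrightarrow> dist 0 w \<le> dist 0 z"
    using distance_attains_inf[of Z 0] by blast
  define x where "x = Re w"
  have wx: "w = of_real x" using real_zeros[of w] w(1) by (simp add: Z_def x_def complex_eq_iff)
  have "w \<noteq> 0" using w(1) f0 by (auto simp: Z_def)
  obtain g where g: "g holomorphic_on UNIV" "\<And>z. f z = (z - w) * g z"
    using entire_divide_zero[OF hol, of w] w(1) by (auto simp: Z_def)
  show ?thesis
  proof (intro exI[of _ "\<lambda>z. - w * g z"] exI[of _ x] conjI allI impI)
    show "(\<lambda>z. - w * g z) holomorphic_on UNIV" by (intro holomorphic_intros g)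
    show "f z = (1 - z / of_real x) * (- w * g z)" for z
    proof -
      have "(1 - z / w) * - w = z - w" using \<open>w \<noteq> 0\<close> by (simp add: algebra_simps)
      then show ?thesis using g(2) wx by (metis mult.assoc)
    qed
    show "x \<noteq> 0" using \<open>w \<noteq> 0\<close> wx by simp
    show "\<bar>x\<bar> \<le> cmod z" if "f z = 0" for z
      using w(2)[of z] that by (simp add: Z_def wx)
    show "f (of_real x) = 0" using w(1) by (simp add: Z_def wx)
  qed (use g(2) in simp)
qed

text \<open>Dependent choice iterates \<open>nearest_real_zero\<close>; \<open>F n\<close> is what
  remains of \<open>f\<close> after n divisions.\<close>

lemma real_zero_sequence:
  assumes hol: "f holomorphic_on UNIV" and f0: "f 0 \<noteq> 0"
    and real_zeros: "\<And>z. f z = 0 \<Longrightarrow> Im z = 0"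
  obtains F :: "nat \<Rightarrow> complex \<Rightarrow> complex" and x :: "nat \<Rightarrow> real"
  where "\<And>n. F n holomorphic_on UNIV" "\<And>n. F n 0 = f 0" "F 0 = f"
    "\<And>n z. F n z = (1 - z / of_real (x n)) * F (Suc n) z"
    "\<And>n z. F n z = 0 \<Longrightarrow> x n \<noteq> 0 \<and> \<bar>x n\<bar> \<le> cmod z"
    "\<And>n. x n \<noteq> 0 \<Longrightarrow> F n (of_real (x n)) = 0"
proof -
  \<comment> \<open>The last conjunct ties the start of the chosen sequence to \<open>f\<close>.
    Realness of the zeros is carried along so that \<open>nearest_real_zero\<close> applies at every
    stage.\<close>
  let ?P = "\<lambda>(n::nat) g. g holomorphic_on UNIV \<and> g 0 = f 0 \<and> (\<forall>z. g z = 0 \<longrightarrow> Im z = 0) \<and> (n = 0 \<longrightarrow> g = f)"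
  let ?Q = "\<lambda>(n::nat) h g. \<exists>x::real. (\<forall>z. h z = (1 - z / of_real x) * g z) \<and>
    (\<forall>z. h z = 0 \<longrightarrow> x \<noteq> 0 \<and> \<bar>x\<bar> \<le> cmod z) \<and> (x \<noteq> 0 \<longrightarrow> h (of_real x) = 0)"
  have "\<exists>F. \<forall>n. ?P n (F n) \<and> ?Q n (F n) (F (Suc n))"
  proof (rule dependent_nat_choice)
    show "\<exists>g. ?P 0 g" using assms by blast
    fix h n assume "?P n h"
    then have h: "h holomorphic_on UNIV" "h 0 = f 0" "\<And>z. h z = 0 \<Longrightarrow> Im z = 0" by auto
    from nearest_real_zero[OF h(1) _ h(3)] h(2) f0 obtain g x where g:
      "g holomorphic_on UNIV" "g 0 = h 0" "\<And>z. h z = (1 - z / of_real x) * g z"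
      "\<forall>z. h z = 0 \<longrightarrow> x \<noteq> 0 \<and> \<bar>x\<bar> \<le> cmod z" "x \<noteq> 0 \<longrightarrow> h (of_real x) = 0"
      by metis
    have "?P (Suc n) g" using g(1-3) h by (metis mult_zero_right nat.distinct(1))
    moreover have "?Q n h g" using g(3-5) by blast
    ultimately show "\<exists>g. ?P (Suc n) g \<and> ?Q n h g" by blast
  qed
  then obtain F where F: "\<forall>n. ?P n (F n) \<and> ?Q n (F n) (F (Suc n))" by (rule exE)
  then have "\<forall>n. ?Q n (F n) (F (Suc n))" by (rule all_conj_distrib[THEN iffD1, THEN conjunct2])
  then obtain x where x: "\<forall>n. (\<forall>z. F n z = (1 - z / of_real (x n)) * F (Suc n) z) \<and>
    (\<forall>z. F n z = 0 \<longrightarrow> x n \<noteq> 0 \<and> \<bar>x n\<bar> \<le> cmod z) \<and> (x n \<noteq> 0 \<longrightarrow> F n (of_real (x n)) = 0)"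
    by (rule choice[THEN exE])
  show thesis
  proof (rule that[of F x])
    show "F n z = (1 - z / of_real (x n)) * F (Suc n) z" for n z
      using x by (rule allE[of _ n]) (elim conjE, erule spec)
    show "F n holomorphic_on UNIV" "F n 0 = f 0" for n using F by blast+
    show "F 0 = f" using F by blast
    show "x n \<noteq> 0 \<and> \<bar>x n\<bar> \<le> cmod z" if "F n z = 0" for n z using x that by blast
    show "F n (of_real (x n)) = 0" if "x n \<noteq> 0" for n using x that by blast
  qed
qed

text \<open>Hadamard's factorization for real zeros. Realness makes the terms 1/x_k^2 nonnegative,
  so bounded partial sums already converge. Growth is asked for outside the unit disc only, because
  \<open>f\<close> will arise by dividing out a power of z.\<close>

lemma real_zeros_factorization:
  fixes B C :: real
  assumes hol: "f holomorphic_on UNIV" and f0: "f 0 \<noteq> 0"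
    and real_zeros: "\<And>z. f z = 0 \<Longrightarrow> Im z = 0"
    and growth: "\<And>z. cmod z \<ge> 1 \<Longrightarrow> cmod (f z) \<le> C * exp (B * (cmod z)\<^sup>2)" and "B \<ge> 0"
  shows "\<exists>x :: nat \<Rightarrow> real. (\<forall>k n. k \<le> n \<longrightarrow> x n \<noteq> 0 \<longrightarrow> x k \<noteq> 0) \<and>
    summable (\<lambda>k. 1 / (x k)\<^sup>2) \<and>
    (\<forall>z. (\<lambda>n. f 0 * exp (log_deriv1 f * z + (log_deriv2 f + of_real (\<Sum>k. 1 / (x k)\<^sup>2)) / 2 * z\<^sup>2)
        * (\<Prod>k<n. (1 - z / of_real (x k)) * exp (z / of_real (x k)))) \<longlonglongrightarrow> f z)"
proof -
  obtain F x where F: "\<And>n. F n holomorphic_on UNIV" "\<And>n. F n 0 = f 0" "F 0 = f"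
    "\<And>n z. F n z = (1 - z / of_real (x n)) * F (Suc n) z"
    "\<And>n z. F n z = 0 \<Longrightarrow> x n \<noteq> 0 \<and> \<bar>x n\<bar> \<le> cmod z"
    "\<And>n. x n \<noteq> 0 \<Longrightarrow> F n (of_real (x n)) = 0"
    using real_zero_sequence[OF hol f0 real_zeros] by metis
  have prodF: "f z = (\<Prod>k<n. 1 - z / of_real (x k)) * F n z" for n z
  proof (induction n)
    case (Suc n) then show ?case using F(4)[of n z] by simp
  qed (simp add: F)
  have Fzero: "F k z = 0" if "k \<le> n" "F n z = 0" for k n z
    using that
  proof (induction n rule: dec_induct)
    case (step n) then show ?case using F(4)[of n z] by simp
  qed
  \<comment> \<open>A zero of \<open>F n\<close> is also one of \<open>F k\<close> for k <= n, and
    \<open>x k\<close> is nearest to 0 among the latter.\<close>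
  have mono: "x k \<noteq> 0 \<and> \<bar>x k\<bar> \<le> \<bar>x n\<bar>" if "k \<le> n" "x n \<noteq> 0" for k n
    using F(5)[OF Fzero[OF that(1) F(6)[OF that(2)]]] by simp
  have ld1: "log_deriv1 (F n) = log_deriv1 f + of_real (\<Sum>k<n. 1 / x k)" for n
  proof (induction n)
    case (Suc n)
    have "log_deriv1 (F n) = log_deriv1 (F (Suc n)) - 1 / of_real (x n)"
      by (rule log_deriv1_factor[OF F(1) _ F(4)]) (use f0 F(2)[of "Suc n"] in simp)
    then show ?case using Suc by (simp add: algebra_simps)
  qed (simp add: F(3))
  have ld2: "log_deriv2 (F n) = log_deriv2 f + of_real (\<Sum>k<n. 1 / (x k)\<^sup>2)" for n
  proof (induction n)
    case (Suc n)
    have "log_deriv2 (F n) = log_deriv2 (F (Suc n)) - 1 / (of_real (x n))\<^sup>2"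
      by (rule log_deriv2_factor[OF F(1) _ F(4)]) (use f0 F(2)[of "Suc n"] in simp)
    then show ?case using Suc by (simp add: algebra_simps)
  qed (simp add: F(3))
  \<comment> \<open>On |w| = 3R every factor 1 - w/x_k with 0 < |x_k| <= R has modulus at least 2,
    while x_k = 0 gives the factor 1. The choice q = 2 serves \<open>escape\<close>, the choice q =
    1 serves \<open>bound\<close>.\<close>
  have Fbound: "cmod (F n z) \<le> (C * exp (B * (3 * R)\<^sup>2)) / q ^ n"
    if R: "R \<ge> 1" and q: "q > 0" "\<And>k. k < n \<Longrightarrow> x k = 0 \<and> q \<le> 1 \<or> \<bar>x k\<bar> \<le> R \<and> x k \<noteq> 0 \<and> q \<le> 2"
      and z: "cmod z \<le> R" for n z R q
  proof (rule entire_max_modulus[OF F(1)[of n], where R = "3 * R"])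
    fix w :: complex assume w: "cmod w = 3 * R"
    have "q \<le> cmod (1 - w / of_real (x k))" if "k < n" for k
    proof (cases "x k = 0")
      case False
      then have "\<bar>x k\<bar> \<le> R" "q \<le> 2" using q(2)[OF that] by auto
      then have "2 \<le> cmod (w / of_real (x k)) - 1"
        using w R False by (simp add: norm_divide field_simps)
      also have "\<dots> \<le> cmod (1 - w / of_real (x k))"
        using norm_triangle_ineq2[of "w / of_real (x k)" 1] by (simp add: norm_minus_commute)
      finally show ?thesis using \<open>q \<le> 2\<close> by simp
    qed (use q(2)[OF that] in auto)
    then have "(\<Prod>k<n. q) \<le> (\<Prod>k<n. cmod (1 - w / of_real (x k)))"
      using q(1) by (intro prod_mono) auto
    then have "q ^ n * cmod (F n w) \<le> (\<Prod>k<n. cmod (1 - w / of_real (x k))) * cmod (F n w)"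
      by (intro mult_right_mono) auto
    also have "\<dots> = cmod (f w)" by (simp add: prodF[of w n] norm_mult prod_norm)
    also have "\<dots> \<le> C * exp (B * (3 * R)\<^sup>2)" using growth[of w] w R by simp
    finally show "cmod (F n w) \<le> C * exp (B * (3 * R)\<^sup>2) / q ^ n"
      using q(1) by (simp add: field_simps)
  qed (use z R in simp)
  \<comment> \<open>If infinitely many zeros stayed in a disc, then |F_n(0)| would decay like 2^{-n}, but it is constant.\<close>
  have escape: "\<exists>N. \<forall>n\<ge>N. x n = 0 \<or> \<bar>x n\<bar> > \<rho>" for \<rho>
  proof (rule ccontr)
    assume neg: "\<not> ?thesis"
    have all: "x k \<noteq> 0 \<and> \<bar>x k\<bar> \<le> max 1 \<rho>" for k
    proof -
      obtain n where "n \<ge> k" "x n \<noteq> 0" "\<bar>x n\<bar> \<le> \<rho>" using neg by (meson not_less)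
      then show ?thesis using mono[of k n] by linarith
    qed
    define M where "M = C * exp (B * (3 * max 1 \<rho>)\<^sup>2)"
    have "cmod (f 0) \<le> M / 2 ^ n" for n
      using Fbound[of "max 1 \<rho>" 2 n 0] all F(2) by (simp add: M_def)
    moreover have "(\<lambda>n. M / 2 ^ n) \<longlonglongrightarrow> 0"
      by (rule LIMSEQ_divide_realpow_zero) simp
    ultimately have "cmod (f 0) \<le> 0"
      by (intro LIMSEQ_le_const[of "\<lambda>n. M / 2 ^ n"]) auto
    then show False using f0 by simp
  qed
  \<comment> \<open>If x n = 0, then \<open>F n\<close> has no zeros and any radius beyond the
    earlier |x_k| will do; otherwise |x n| works, being the distance from 0 to the nearest zero of
    \<open>F n\<close>.\<close>
  have radius: "\<exists>N. \<forall>n\<ge>N. \<exists>R\<ge>\<rho>. R \<ge> 1 \<and> (\<forall>k<n. \<bar>x k\<bar> \<le> R) \<and> (\<forall>z\<in>ball 0 R. F n z \<noteq> 0)" for \<rho>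
  proof -
    obtain N where N: "\<And>n. n \<ge> N \<Longrightarrow> x n = 0 \<or> \<bar>x n\<bar> > max 1 \<rho>" using escape by blast
    have "\<exists>R\<ge>\<rho>. R \<ge> 1 \<and> (\<forall>k<n. \<bar>x k\<bar> \<le> R) \<and> (\<forall>z\<in>ball 0 R. F n z \<noteq> 0)" if "n \<ge> N" for n
    proof (cases "x n = 0")
      case True
      define R where "R = max 1 \<rho> + (\<Sum>k<n. \<bar>x k\<bar>)"
      have "(\<Sum>k<n. \<bar>x k\<bar>) \<ge> 0" by (simp add: sum_nonneg)
      then have R: "R \<ge> \<rho>" "R \<ge> 1" unfolding R_def by linarith+
      have "\<bar>x k\<bar> \<le> R" if "k < n" for k
        using member_le_sum[of k "{..<n}" "\<lambda>k. \<bar>x k\<bar>"] that by (simp add: R_def)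
      then show ?thesis using True F(5) R by blast
    next
      case False
      then have "\<bar>x n\<bar> > max 1 \<rho>" using N[OF that] by simp
      then show ?thesis using mono[of _ n] False F(5)[of n]
        by (intro exI[of _ "\<bar>x n\<bar>"]) (auto simp: not_le[symmetric])
    qed
    then show ?thesis by blast
  qed
  \<comment> \<open>\<open>K\<close> absorbs \<open>C\<close> into exp K * |f 0|, because the
    zero-free estimates compare with the value at 0; \<open>C + 1\<close> makes the inequality
    strict.\<close>
  define K where "K = max 0 (ln ((C + 1) / cmod (f 0)))"
  have C: "C \<ge> 0"
  proof -
    have "0 \<le> C * exp (B * (cmod 1)\<^sup>2)" using growth[of 1] norm_ge_zero[of "f 1"] by (simp del: norm_ge_zero)
    then show ?thesis by (simp add: zero_le_mult_iff)
  qed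
  have K: "C < exp K * cmod (f 0)" "K \<ge> 0"
  proof -
    have "(C + 1) / cmod (f 0) = exp (ln ((C + 1) / cmod (f 0)))" using C f0 by simp
    also have "\<dots> \<le> exp K" by (simp add: K_def)
    finally have "(C + 1) / cmod (f 0) \<le> exp K" .
    then show "C < exp K * cmod (f 0)" using f0 by (simp add: field_simps)
  qed (simp add: K_def)
  \<comment> \<open>The 9 comes from the radius 3R, and K <= K R^2 for R >= 1.\<close>
  define D where "D = 9 * B + K"
  have D: "D \<ge> 0" using K(2) \<open>B \<ge> 0\<close> by (simp add: D_def)
  have bound: "cmod (F n z) < exp (D * R\<^sup>2) * cmod (F n 0)"
    if "R \<ge> 1" "\<forall>k<n. \<bar>x k\<bar> \<le> R" "z \<in> ball 0 R" for n R z
  proof -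
    have "cmod (F n z) \<le> C * exp (B * (3 * R)\<^sup>2)"
      using Fbound[of R 1 n z] that by fastforce
    also have "\<dots> < (exp K * cmod (f 0)) * exp (B * (3 * R)\<^sup>2)"
      using K by simp
    also have "\<dots> = exp (K + 9 * B * R\<^sup>2) * cmod (f 0)"
      by (simp add: exp_add power2_eq_square)
    also have "\<dots> \<le> exp (D * R\<^sup>2) * cmod (f 0)"
    proof -
      have "K * 1 \<le> K * R\<^sup>2" using K that(1) by (intro mult_left_mono) auto
      then show ?thesis by (intro mult_right_mono) (auto simp: D_def algebra_simps)
    qed
    finally show ?thesis by (simp add: F(2))
  qed
  \<comment> \<open>The R^2 in the growth bound cancels the 1/R^2 of
    \<open>zero_free_log_deriv2_le\<close>, leaving a bound free of n. Passing to
    \<open>max n N\<close> secures a zero-free disc and only enlarges the sum.\<close>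
  have sums_le: "(\<Sum>k<n. 1 / (x k)\<^sup>2) \<le> cmod (log_deriv2 f) + 16 * D" for n
  proof -
    obtain N where "\<forall>n\<ge>N. \<exists>R\<ge>1. R \<ge> 1 \<and> (\<forall>k<n. \<bar>x k\<bar> \<le> R) \<and> (\<forall>z\<in>ball 0 R. F n z \<noteq> 0)"
      using radius by blast
    then obtain R where R: "R \<ge> 1" "\<forall>k<max n N. \<bar>x k\<bar> \<le> R" "\<forall>z\<in>ball 0 R. F (max n N) z \<noteq> 0"
      by (meson max.cobounded2)
    let ?m = "max n N"
    have "F ?m holomorphic_on ball 0 R" using F(1) holomorphic_on_subset by blast
    then have "cmod (log_deriv2 (F ?m)) \<le> 16 * (D * R\<^sup>2) / R\<^sup>2"
      by (rule zero_free_log_deriv2_le) (use R bound in auto)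
    then have "cmod (log_deriv2 (F ?m)) \<le> 16 * D" using R(1) by simp
    moreover have "of_real (\<Sum>k<?m. 1 / (x k)\<^sup>2) = log_deriv2 (F ?m) - log_deriv2 f"
      by (simp add: ld2)
    then have "\<bar>\<Sum>k<?m. 1 / (x k)\<^sup>2\<bar> \<le> cmod (log_deriv2 (F ?m)) + cmod (log_deriv2 f)"
      by (metis norm_of_real norm_triangle_ineq4)
    moreover have "(\<Sum>k<n. 1 / (x k)\<^sup>2) \<le> (\<Sum>k<?m. 1 / (x k)\<^sup>2)"
      by (rule sum_mono2) auto
    ultimately show ?thesis by linarith
  qed
  have summ: "summable (\<lambda>k. 1 / (x k)\<^sup>2)"
    by (rule bounded_imp_summable[where B = "cmod (log_deriv2 f) + 16 * D"])
      (use sums_le[of "Suc _"] in \<open>auto simp: lessThan_Suc_atMost\<close>)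
  define S where "S = (\<Sum>k. 1 / (x k)\<^sup>2)"
  have S_lim: "(\<lambda>n. \<Sum>k<n. 1 / (x k)\<^sup>2) \<longlonglongrightarrow> S"
    unfolding S_def using summ by (rule summable_LIMSEQ)
  \<comment> \<open>The partial product differs from \<open>f z\<close> by a factor exp w, where w
    combines the tail of the sum of 1/x_k^2, times z^2/2, with the cubic remainder e; both tend to
    0.\<close>
  have lim: "(\<lambda>n. f 0 * exp (log_deriv1 f * z + (log_deriv2 f + of_real S) / 2 * z\<^sup>2)
        * (\<Prod>k<n. (1 - z / of_real (x k)) * exp (z / of_real (x k)))) \<longlonglongrightarrow> f z" (is "?T \<longlonglongrightarrow> _") for z
  proof (rule LIMSEQ_I)
    fix \<epsilon> :: real assume "\<epsilon> > 0"
    have "isCont (\<lambda>w. f z * exp w) 0" by (intro continuous_intros)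
    then obtain \<delta> where \<delta>: "\<delta> > 0" "\<And>w. cmod w < \<delta> \<Longrightarrow> cmod (f z * exp w - f z) < \<epsilon>"
      using \<open>\<epsilon> > 0\<close> by (force simp: continuous_at_eps_delta dist_norm)
    have "(\<lambda>n. of_real (S - (\<Sum>k<n. 1 / (x k)\<^sup>2)) / 2 * z\<^sup>2) \<longlonglongrightarrow> of_real (S - S) / 2 * z\<^sup>2"
      by (intro tendsto_intros S_lim) auto
    from LIMSEQ_D[OF this, of "\<delta> / 2"] \<delta>(1) obtain N1 where N1:
      "\<And>n. n \<ge> N1 \<Longrightarrow> cmod (of_real (S - (\<Sum>k<n. 1 / (x k)\<^sup>2)) / 2 * z\<^sup>2) < \<delta> / 2" by auto
    \<comment> \<open>The first entry ensures |z| <= R/4; the second makes the remainder bound 384 D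
      |z|^3 / R smaller than \<open>\<delta> / 2\<close>.\<close>
    define \<rho> where "\<rho> = max (4 * cmod z) (2 * (384 * D * cmod z ^ 3) / \<delta> + 1)"
    obtain N2 where N2: "\<And>n. n \<ge> N2 \<Longrightarrow>
      \<exists>R\<ge>\<rho>. R \<ge> 1 \<and> (\<forall>k<n. \<bar>x k\<bar> \<le> R) \<and> (\<forall>z\<in>ball 0 R. F n z \<noteq> 0)"
      using radius by blast
    show "\<exists>no. \<forall>n\<ge>no. cmod (?T n - f z) < \<epsilon>"
    proof (intro exI allI impI)
      fix n assume n: "n \<ge> max N1 N2"
      then obtain R where R: "R \<ge> \<rho>" "R \<ge> 1" "\<forall>k<n. \<bar>x k\<bar> \<le> R" "\<forall>z\<in>ball 0 R. F n z \<noteq> 0"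
        using N2[of n] by auto
      have "F n holomorphic_on ball 0 R" using F(1) holomorphic_on_subset by blast
      moreover have "cmod z \<le> R / 4" using R(1) by (simp add: \<rho>_def)
      ultimately have "\<exists>e. cmod e \<le> 384 * (D * R\<^sup>2) * cmod z ^ 3 / R ^ 3 \<and>
          F n z = F n 0 * exp (log_deriv1 (F n) * z + log_deriv2 (F n) / 2 * z\<^sup>2 + e)"
        by (intro zero_free_expansion) (use R bound in auto)
      then obtain e where e: "cmod e \<le> 384 * (D * R\<^sup>2) * cmod z ^ 3 / R ^ 3"
        "F n z = F n 0 * exp (log_deriv1 (F n) * z + log_deriv2 (F n) / 2 * z\<^sup>2 + e)" by blast
      have "384 * (D * R\<^sup>2) * cmod z ^ 3 / R ^ 3 = 384 * D * cmod z ^ 3 / R"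
        using R(2) by (simp add: field_simps power2_eq_square power3_eq_cube)
      also have "\<dots> < \<delta> / 2"
      proof -
        have "2 * (384 * D * cmod z ^ 3) / \<delta> < R" using R(1) by (simp add: \<rho>_def)
        then show ?thesis using \<delta>(1) R(2) by (simp add: field_simps)
      qed
      finally have e_less: "cmod e < \<delta> / 2" using e(1) by simp
      define w where "w = of_real (S - (\<Sum>k<n. 1 / (x k)\<^sup>2)) / 2 * z\<^sup>2 - e"
      have "cmod w < \<delta>"
        using N1[of n] n e_less norm_triangle_ineq4[of "of_real (S - (\<Sum>k<n. 1 / (x k)\<^sup>2)) / 2 * z\<^sup>2" e]
        by (simp add: w_def)
      moreover have "?T n = f z * exp w"
      proof -
        define u where "u = log_deriv1 f * z + (log_deriv2 f + of_real S) / 2 * z\<^sup>2"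
        \<comment> \<open>The convergence factors multiply to exp v, and v is exactly the change in
          the linear term from \<open>log_deriv1 f\<close> to
          \<open>log_deriv1 (F n)\<close>.\<close>
        define v where "v = of_real (\<Sum>k<n. 1 / x k) * z"
        have "(\<Prod>k<n. (1 - z / of_real (x k)) * exp (z / of_real (x k)))
            = (\<Prod>k<n. 1 - z / of_real (x k)) * exp v"
          by (simp add: v_def prod.distrib exp_sum[symmetric] sum_distrib_right)
        then have "?T n = (\<Prod>k<n. 1 - z / of_real (x k)) * (f 0 * exp (u + v))"
          by (simp add: u_def exp_add)
        also have "u + v = (log_deriv1 (F n) * z + log_deriv2 (F n) / 2 * z\<^sup>2 + e) + w"
          unfolding u_def v_def ld1 ld2 w_def by (simp add: field_simps)
        finally have "?T n = (\<Prod>k<n. 1 - z / of_real (x k)) *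
            (f 0 * exp ((log_deriv1 (F n) * z + log_deriv2 (F n) / 2 * z\<^sup>2 + e) + w))" .
        then show ?thesis using prodF[of z n] by (simp add: e(2) F(2) exp_add)
      qed
      ultimately show "cmod (?T n - f z) < \<epsilon>" using \<delta>(2) by simp
    qed
  qed
  have "\<forall>k n. k \<le> n \<longrightarrow> x n \<noteq> 0 \<longrightarrow> x k \<noteq> 0" using mono by blast
  then show ?thesis
    using summ allI[OF lim] unfolding S_def by (intro exI[of _ x] conjI)
qed

section \<open>Growth and type\<close>

text \<open>|1 - u|^2 = 1 + |u|^2 - 2 Re u <= exp (|u|^2 - 2 Re u), and the term 2 Re u cancels
  against |exp u|^2.\<close>

lemma norm_elementary_factor_le:
  "cmod ((1 - u) * exp u) \<le> exp ((cmod u)\<^sup>2 / 2)"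
proof (rule power2_le_imp_le)
  have "(cmod ((1 - u) * exp u))\<^sup>2 = (1 + ((cmod u)\<^sup>2 - 2 * Re u)) * exp (2 * Re u)"
    by (simp add: norm_mult power_mult_distrib cmod_power2 exp_double[symmetric])
      (simp add: power2_eq_square algebra_simps)
  also have "\<dots> \<le> exp ((cmod u)\<^sup>2 - 2 * Re u) * exp (2 * Re u)"
    by (intro mult_right_mono exp_ge_add_one_self) simp
  also have "\<dots> = (exp ((cmod u)\<^sup>2 / 2))\<^sup>2"
    by (simp add: exp_add[symmetric] exp_double[symmetric])
  finally show "(cmod ((1 - u) * exp u))\<^sup>2 \<le> (exp ((cmod u)\<^sup>2 / 2))\<^sup>2" .
qed simp

text \<open>For the finitely many leading factors, whose quadratic exponents need not be small in
  total.\<close>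

lemma norm_elementary_factor_le':
  "cmod ((1 - u) * exp u) \<le> exp (2 * cmod u)"
proof -
  have "cmod (1 - u) \<le> 1 + cmod u" using norm_triangle_ineq4[of 1 u] by simp
  also have "\<dots> \<le> exp (cmod u)" by (rule exp_ge_add_one_self)
  finally have "cmod (1 - u) * cmod (exp u) \<le> exp (cmod u) * exp (cmod u)"
    using complex_Re_le_cmod[of u] by (intro mult_mono) auto
  then show ?thesis by (simp add: norm_mult exp_double[symmetric] power2_eq_square exp_add[symmetric])
qed

lemma power_le_fact_exp:
  fixes x :: real assumes "x \<ge> 0" shows "x ^ m \<le> fact m * exp x"
proof -
  have "(\<Sum>n\<in>{m}. x ^ n /\<^sub>R fact n) \<le> exp x"
    unfolding exp_def by (rule sum_le_suminf[OF summable_exp_generic]) (use assms in auto)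
  then show ?thesis by (simp add: field_simps)
qed

text \<open>The leading factors contribute a linear exponent, and the tail of the sum of 1/x_k^2 is
  below \<open>\<epsilon>\<close>. The bound is uniform in n, so it survives the limit.\<close>

lemma norm_genus_one_product_le:
  assumes "summable (\<lambda>k. 1 / (x k)\<^sup>2)" "\<epsilon> > 0"
  shows "\<exists>K\<ge>0. \<forall>n z. cmod (\<Prod>k<n. (1 - z / of_real (x k)) * exp (z / of_real (x k)))
    \<le> exp (K * cmod z + \<epsilon> * (cmod z)\<^sup>2)"
proof -
  obtain N where N: "\<And>m n. m \<ge> N \<Longrightarrow> norm (\<Sum>k=m..<n. 1 / (x k)\<^sup>2) < \<epsilon>"
    using assms unfolding summable_Cauchy by blast
  define K where "K = (\<Sum>k<N. 2 / \<bar>x k\<bar>)"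
  have "cmod (\<Prod>k<n. (1 - z / of_real (x k)) * exp (z / of_real (x k)))
    \<le> exp (K * cmod z + \<epsilon> * (cmod z)\<^sup>2)" for n z
  proof -
    define t where "t k = (if k < N then 2 / \<bar>x k\<bar> * cmod z else 1 / (x k)\<^sup>2 * (cmod z)\<^sup>2)" for k
    have t0: "t k \<ge> 0" for k by (simp add: t_def)
    have "cmod (\<Prod>k<n. (1 - z / of_real (x k)) * exp (z / of_real (x k))) \<le> (\<Prod>k<n. exp (t k))"
      unfolding prod_norm[symmetric]
    proof (intro prod_mono conjI norm_ge_zero)
      fix k
      show "cmod ((1 - z / of_real (x k)) * exp (z / of_real (x k))) \<le> exp (t k)"
      proof (cases "k < N")
        case True
        then show ?thesis using norm_elementary_factor_le'[of "z / of_real (x k)"]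
          by (simp add: t_def norm_divide)
      next
        case False
        have "cmod ((1 - z / of_real (x k)) * exp (z / of_real (x k))) \<le>
            exp ((cmod (z / of_real (x k)))\<^sup>2 / 2)"
          by (rule norm_elementary_factor_le)
        also have "\<dots> \<le> exp ((cmod (z / of_real (x k)))\<^sup>2)" by simp
        also have "\<dots> = exp (t k)" using False by (simp add: t_def norm_divide power_divide)
        finally show ?thesis .
      qed
    qed
    also have "\<dots> = exp (\<Sum>k<n. t k)" by (simp add: exp_sum)
    \<comment> \<open>Padding to N + n terms allows the split at N even when n < N.\<close>
    also have "(\<Sum>k<n. t k) \<le> (\<Sum>k<N + n. t k)" by (rule sum_mono2) (use t0 in auto)
    also have "\<dots> = (\<Sum>k<N. t k) + (\<Sum>k=N..<N + n. t k)"
      by (simp add: lessThan_atLeast0 sum.atLeastLessThan_concat)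
    also have "(\<Sum>k<N. t k) = K * cmod z"
      unfolding K_def sum_distrib_right by (rule sum.cong) (auto simp: t_def)
    also have "(\<Sum>k=N..<N + n. t k) = (\<Sum>k=N..<N + n. 1 / (x k)\<^sup>2) * (cmod z)\<^sup>2"
      unfolding sum_distrib_right by (rule sum.cong) (auto simp: t_def)
    also have "\<dots> \<le> \<epsilon> * (cmod z)\<^sup>2"
      using N[of N "N + n"] by (intro mult_right_mono) auto
    finally show ?thesis by simp
  qed
  moreover have "K \<ge> 0" by (simp add: K_def sum_nonneg)
  ultimately show ?thesis by blast
qed

text \<open>Once exp (A z^2) is removed, a power, an exponential of order 1 and the genus one
  product remain; each is dominated by any positive quadratic exponent.\<close>

lemma minimal_type_of_factorization:
  fixes A b c :: complex
  assumes summ: "summable (\<lambda>k. 1 / (x k)\<^sup>2)" and "\<epsilon> > 0"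
    and lim: "\<And>z. (\<lambda>n. c * z ^ m * exp (A * z\<^sup>2 + b * z) *
        (\<Prod>k<n. (1 - z / of_real (x k)) * exp (z / of_real (x k)))) \<longlonglongrightarrow> \<phi> z"
  shows "\<exists>C>0. \<forall>z. cmod (\<phi> z * exp (- A * z\<^sup>2)) \<le> C * exp (\<epsilon> * (cmod z)\<^sup>2)"
proof -
  obtain K where K: "K \<ge> 0" "\<And>n z. cmod (\<Prod>k<n. (1 - z / of_real (x k)) * exp (z / of_real (x k)))
    \<le> exp (K * cmod z + \<epsilon> / 2 * (cmod z)\<^sup>2)"
    using norm_genus_one_product_le[OF summ, of "\<epsilon> / 2"] \<open>\<epsilon> > 0\<close> by auto
  \<comment> \<open>The linear rates add up: 1 from |z|^m <= m! exp |z|, \<open>cmod b\<close> from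
    exp (b z), and \<open>K\<close> from the product.\<close>
  define K' where "K' = 1 + cmod b + K"
  define C where "C = (1 + cmod c * fact m) * exp (K'\<^sup>2 / (2 * \<epsilon>))"
  have "cmod (\<phi> z * exp (- A * z\<^sup>2)) \<le> C * exp (\<epsilon> * (cmod z)\<^sup>2)" for z
  proof -
    let ?P = "\<lambda>n. \<Prod>k<n. (1 - z / of_real (x k)) * exp (z / of_real (x k))"
    have "(\<lambda>n. cmod (c * z ^ m * exp (A * z\<^sup>2 + b * z) * ?P n * exp (- A * z\<^sup>2)))
        \<longlonglongrightarrow> cmod (\<phi> z * exp (- A * z\<^sup>2))"
      by (intro tendsto_intros lim)
    moreover have "cmod (c * z ^ m * exp (A * z\<^sup>2 + b * z) * ?P n * exp (- A * z\<^sup>2))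
        \<le> C * exp (\<epsilon> * (cmod z)\<^sup>2)" for n
    proof -
      have "c * z ^ m * exp (A * z\<^sup>2 + b * z) * ?P n * exp (- A * z\<^sup>2)
          = c * z ^ m * exp (b * z) * ?P n"
        by (simp add: exp_add exp_minus)
      also have "cmod \<dots> = cmod c * cmod z ^ m * exp (Re (b * z)) * cmod (?P n)"
        by (simp add: norm_mult norm_power)
      also have "\<dots> \<le> cmod c * (fact m * exp (cmod z)) * exp (cmod b * cmod z)
          * exp (K * cmod z + \<epsilon> / 2 * (cmod z)\<^sup>2)"
        using complex_Re_le_cmod[of "b * z"]
        by (intro mult_mono K power_le_fact_exp) (auto simp: norm_mult)
      also have "\<dots> = cmod c * fact m * exp (K' * cmod z + \<epsilon> / 2 * (cmod z)\<^sup>2)"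
        by (simp add: K'_def exp_add[symmetric] algebra_simps)
      also have "\<dots> \<le> (1 + cmod c * fact m) * exp (K'\<^sup>2 / (2 * \<epsilon>) + \<epsilon> * (cmod z)\<^sup>2)"
      proof (intro mult_mono)
        \<comment> \<open>Completing the square trades K' |z| for (epsilon/2) |z|^2 plus a
          constant.\<close>
        have "0 \<le> (K' - \<epsilon> * cmod z)\<^sup>2 / (2 * \<epsilon>)" using \<open>\<epsilon> > 0\<close> by simp
        also have "\<dots> = K'\<^sup>2 / (2 * \<epsilon>) - K' * cmod z + \<epsilon> / 2 * (cmod z)\<^sup>2"
          using \<open>\<epsilon> > 0\<close> by (simp add: field_simps power2_eq_square)
        finally show "exp (K' * cmod z + \<epsilon> / 2 * (cmod z)\<^sup>2) \<le> exp (K'\<^sup>2 / (2 * \<epsilon>) + \<epsilon> * (cmod z)\<^sup>2)"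
          by simp
      qed auto
      also have "\<dots> = C * exp (\<epsilon> * (cmod z)\<^sup>2)" by (simp add: C_def exp_add)
      finally show ?thesis .
    qed
    ultimately show ?thesis by (intro LIMSEQ_le_const2) auto
  qed
  moreover have "C > 0" by (simp add: C_def add_pos_nonneg)
  ultimately show ?thesis by blast
qed

text \<open>n |a_n|^(2/n) <= D means |a_n|^2 <= (D/n)^n. With y <= exp y at y = 4 D r^2 / n this
  gives |a_n| (2r)^n <= exp (2 D r^2); using 2r instead of r leaves a geometric series of ratio
  1/2.\<close>

lemma growth_of_limsup:
  fixes a :: "nat \<Rightarrow> real"
  assumes lim_fin: "limsup (\<lambda>n. ereal (real n * \<bar>a n\<bar> powr (2 / real n))) < \<infinity>"
  shows "\<exists>C B. B \<ge> 0 \<and> (\<forall>z::complex. cmod (\<Sum>n. of_real (a n) * z ^ n) \<le> C * exp (B * (cmod z)\<^sup>2))"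
proof -
  define t where "t n = real n * \<bar>a n\<bar> powr (2 / real n)" for n
  obtain D0 where "limsup (\<lambda>n. ereal (t n)) < ereal D0"
    using ereal_dense2[OF lim_fin] by (auto simp: t_def)
  from Limsup_lessD[OF this] obtain N where N: "\<And>n. n \<ge> N \<Longrightarrow> t n < D0"
    by (auto simp: eventually_sequentially)
  \<comment> \<open>Adding the finitely many early values makes \<open>D\<close> an upper bound for
    every \<open>t n\<close>.\<close>
  define D where "D = \<bar>D0\<bar> + (\<Sum>n<N. t n)"
  have t0: "t n \<ge> 0" for n by (simp add: t_def)
  have tD: "t n \<le> D" for n
  proof (cases "n < N")
    case True
    then have "t n \<le> (\<Sum>n<N. t n)" using t0 by (intro member_le_sum) auto
    then show ?thesis by (simp add: D_def)
  next
    case False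
    have "(\<Sum>n<N. t n) \<ge> 0" by (simp add: sum_nonneg t0)
    then show ?thesis using N[of n] False by (simp add: D_def)
  qed
  have D: "D \<ge> 0" using tD[of 0] t0[of 0] by linarith
  have term_le: "\<bar>a n\<bar> * (2 * r) ^ n \<le> exp (2 * D * r\<^sup>2)" if "n \<ge> 1" "r \<ge> 0" for n r
  proof (rule power2_le_imp_le)
    have "(\<bar>a n\<bar> powr (2 / real n)) ^ n = (\<bar>a n\<bar>)\<^sup>2"
    proof (cases "a n = 0")
      case False
      then have "(\<bar>a n\<bar> powr (2 / real n)) ^ n = (\<bar>a n\<bar> powr (2 / real n)) powr real n"
        by (simp add: powr_realpow)
      also have "\<dots> = \<bar>a n\<bar> powr (2 / real n * real n)" by (rule powr_powr)
      also have "\<dots> = \<bar>a n\<bar> powr 2" using that by simp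
      also have "\<dots> = (\<bar>a n\<bar>)\<^sup>2" using False powr_realpow[of "\<bar>a n\<bar>" 2] by simp
      finally show ?thesis .
    qed (use that in simp)
    moreover have "(\<bar>a n\<bar> * y ^ n)\<^sup>2 = (\<bar>a n\<bar>)\<^sup>2 * (y\<^sup>2) ^ n" for y
      unfolding power_mult_distrib power_mult[symmetric] by (simp add: mult.commute)
    ultimately have "(\<bar>a n\<bar> * (2 * r) ^ n)\<^sup>2 = (\<bar>a n\<bar> powr (2 / real n) * (2 * r)\<^sup>2) ^ n"
      by (simp only: power_mult_distrib[of _ "(2 * r)\<^sup>2"])
    also have "(2 * r)\<^sup>2 = 4 * r\<^sup>2" by (simp add: power_mult_distrib)
    also have "(\<bar>a n\<bar> powr (2 / real n) * (4 * r\<^sup>2)) ^ n \<le> exp (4 * D * r\<^sup>2 / real n) ^ n"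
    proof (rule power_mono)
      have "\<bar>a n\<bar> powr (2 / real n) \<le> D / real n"
        using tD[of n] that by (simp add: t_def field_simps)
      then have "\<bar>a n\<bar> powr (2 / real n) * (4 * r\<^sup>2) \<le> D / real n * (4 * r\<^sup>2)"
        by (intro mult_right_mono) auto
      also have "D / real n * (4 * r\<^sup>2) = 4 * D * r\<^sup>2 / real n" by simp
      also have "\<dots> \<le> exp (4 * D * r\<^sup>2 / real n)"
        using exp_ge_add_one_self[of "4 * D * r\<^sup>2 / real n"] by linarith
      finally show "\<bar>a n\<bar> powr (2 / real n) * (4 * r\<^sup>2) \<le> exp (4 * D * r\<^sup>2 / real n)" .
    qed simp
    also have "\<dots> = (exp (2 * D * r\<^sup>2))\<^sup>2"
      using that by (simp add: exp_of_nat_mult[symmetric] exp_double[symmetric])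
    finally show "(\<bar>a n\<bar> * (2 * r) ^ n)\<^sup>2 \<le> (exp (2 * D * r\<^sup>2))\<^sup>2" .
  qed simp
  have "cmod (\<Sum>n. of_real (a n) * z ^ n) \<le> 2 * (1 + \<bar>a 0\<bar>) * exp (2 * D * (cmod z)\<^sup>2)" for z :: complex
  proof -
    let ?E = "(1 + \<bar>a 0\<bar>) * exp (2 * D * (cmod z)\<^sup>2)"
    have le: "cmod (of_real (a n) * z ^ n) \<le> ?E * (1 / 2) ^ n" for n
    proof (cases "n = 0")
      case True
      have "\<bar>a 0\<bar> * 1 \<le> (1 + \<bar>a 0\<bar>) * exp (2 * D * (cmod z)\<^sup>2)"
        using D by (intro mult_mono) auto
      then show ?thesis using True by simp
    next
      case False
      have "\<bar>a n\<bar> * (2 * cmod z) ^ n \<le> 1 * exp (2 * D * (cmod z)\<^sup>2)" using term_le[of n "cmod z"] False by simp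
      also have "\<dots> \<le> ?E" by (intro mult_right_mono) auto
      finally show ?thesis by (simp add: norm_mult norm_power power_mult_distrib power_divide field_simps)
    qed
    have "(\<lambda>n. ?E * (1 / 2) ^ n) sums (?E * (1 / (1 - 1 / 2)))"
      by (intro sums_mult geometric_sums) simp
    then have sm: "summable (\<lambda>n. ?E * (1 / 2) ^ n)" "(\<Sum>n. ?E * (1 / 2) ^ n) = 2 * ?E"
      by (auto simp: sums_iff)
    show ?thesis using norm_suminf_le[OF le sm(1)] unfolding sm(2) by (simp only: mult.assoc)
  qed
  then show ?thesis using D by (intro exI[of _ "2 * (1 + \<bar>a 0\<bar>)"] exI[of _ "2 * D"]) auto
qed

text \<open>Cauchy's inequality on |z| = sqrt (n/epsilon) gives n |a_n|^(2/n) <= C^(2/n) e^2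
  epsilon, and C^(2/n) tends to 1.\<close>

lemma limsup_le_of_minimal_type:
  fixes a :: "nat \<Rightarrow> real"
  assumes entire: "\<And>z::complex. summable (\<lambda>n. of_real (a n) * z ^ n)"
    and min: "\<And>\<epsilon>. \<epsilon> > 0 \<Longrightarrow> \<exists>C>0. \<forall>z::complex. cmod (\<Sum>n. of_real (a n) * z ^ n) \<le> C * exp (\<epsilon> * (cmod z)\<^sup>2)"
  shows "limsup (\<lambda>n. ereal (real n * \<bar>a n\<bar> powr (2 / real n))) \<le> 0"
proof (rule ccontr)
  assume "\<not> ?thesis"
  then have "0 < limsup (\<lambda>n. ereal (real n * \<bar>a n\<bar> powr (2 / real n)))" by (simp add: not_le)
  from ereal_dense2[OF this] obtain \<delta> where
    \<delta>: "0 < ereal \<delta>" "ereal \<delta> < limsup (\<lambda>n. ereal (real n * \<bar>a n\<bar> powr (2 / real n)))" by blast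
  \<comment> \<open>Chosen so that C^(2/n) e^2 epsilon is at most \<open>\<delta>\<close> as soon as
    C^(2/n) < 2.\<close>
  define \<epsilon> where "\<epsilon> = \<delta> / (2 * exp 2)"
  have \<epsilon>: "\<epsilon> > 0" using \<delta>(1) by (simp add: \<epsilon>_def)
  obtain C where C: "C > 0" "\<And>z::complex. cmod (\<Sum>n. of_real (a n) * z ^ n) \<le> C * exp (\<epsilon> * (cmod z)\<^sup>2)"
    using min[OF \<epsilon>] by blast
  have le: "real n * \<bar>a n\<bar> powr (2 / real n) \<le> C powr (2 / real n) * (exp 2 * \<epsilon>)" if "n \<ge> 1" for n
  proof -
    define r where "r = sqrt (real n / \<epsilon>)"
    have r: "r > 0" "r\<^sup>2 = real n / \<epsilon>" using that \<epsilon> by (auto simp: r_def)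
    have "cmod ((deriv ^^ n) (\<lambda>z. \<Sum>n. of_real (a n) * z ^ n) 0) \<le> fact n * (C * exp (real n)) / r ^ n"
    proof (rule entire_Cauchy_inequality[OF holomorphic_entire_power_series[OF entire] r(1)])
      fix z :: complex assume "cmod z = r"
      then have "\<epsilon> * (cmod z)\<^sup>2 = real n" using r(2) \<epsilon> by simp
      then show "cmod (\<Sum>n. of_real (a n) * z ^ n) \<le> C * exp (real n)" using C(2)[of z] by simp
    qed
    then have "fact n * \<bar>a n\<bar> \<le> fact n * (C * exp (real n) / r ^ n)"
      by (simp add: higher_deriv_entire_power_series[OF entire] norm_mult)
    from mult_left_le_imp_le[OF this] have "\<bar>a n\<bar> \<le> C * exp (real n) / r ^ n" by simp
    then have "\<bar>a n\<bar> powr (2 / real n) \<le> (C * exp (real n) / r ^ n) powr (2 / real n)"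
      by (intro powr_mono2) auto
    also have "\<dots> = C powr (2 / real n) * exp 2 / r\<^sup>2"
    proof -
      have "exp (real n) powr (2 / real n) = exp 2" using that by (simp add: exp_powr_real)
      moreover have "(r ^ n) powr (2 / real n) = r\<^sup>2"
      proof -
        have "(r ^ n) powr (2 / real n) = r powr (real n * (2 / real n))"
          using r(1) by (simp only: powr_realpow[symmetric] powr_powr)
        also have "real n * (2 / real n) = 2" using that by simp
        also have "r powr 2 = r\<^sup>2" using powr_realpow[OF r(1), of 2] by simp
        finally show ?thesis .
      qed
      ultimately show ?thesis using C(1) r(1) by (simp add: powr_divide powr_mult)
    qed
    finally have "real n * \<bar>a n\<bar> powr (2 / real n) \<le> real n * (C powr (2 / real n) * exp 2 / r\<^sup>2)"
      by (intro mult_left_mono) auto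
    then show ?thesis using that \<epsilon> by (simp add: r(2) field_simps)
  qed
  have "(\<lambda>n. C powr (2 / real n)) \<longlonglongrightarrow> C powr 0"
    by (intro tendsto_intros tendsto_divide_0[OF tendsto_const] filterlim_at_top_imp_at_infinity
        filterlim_real_sequentially) (use C in auto)
  then have "\<forall>\<^sub>F n in sequentially. C powr (2 / real n) < 2"
    by (rule order_tendstoD(2)) (use C in simp)
  then have "\<forall>\<^sub>F n in sequentially. ereal (real n * \<bar>a n\<bar> powr (2 / real n)) \<le> ereal \<delta>"
    using eventually_ge_at_top[of 1]
  proof eventually_elim
    case (elim n)
    have "C powr (2 / real n) * (exp 2 * \<epsilon>) \<le> 2 * (exp 2 * \<epsilon>)"
      using elim \<epsilon> by (intro mult_right_mono) auto
    then show ?case using le[of n] elim by (simp add: \<epsilon>_def)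
  qed
  then have "limsup (\<lambda>n. ereal (real n * \<bar>a n\<bar> powr (2 / real n))) \<le> ereal \<delta>"
    by (rule Limsup_bounded)
  then show False using \<delta>(2) by simp
qed

section \<open>Newton series with many zeros\<close>

text \<open>The left side is one term in the expansion of (x + (1 - x))^(R + j) = 1.\<close>

lemma binomial_power_le:
  fixes x :: real
  assumes "0 \<le> x" "x \<le> 1"
  shows "real ((R + j) choose j) * x ^ j * (1 - x) ^ R \<le> 1"
proof -
  have "real ((R + j) choose j) * x ^ j * (1 - x) ^ (R + j - j)
      \<le> (\<Sum>k\<le>R + j. real ((R + j) choose k) * x ^ k * (1 - x) ^ (R + j - k))"
    using assms by (intro member_le_sum) auto
  also have "\<dots> = (x + (1 - x)) ^ (R + j)"
    unfolding binomial_ring[of x "1 - x"] ..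
  also have "\<dots> = 1" by simp
  finally show ?thesis unfolding diff_add_inverse2 .
qed

text \<open>Each |t - i| is at most R + i + 1, and the product of (R + i + 1)/(i + 1) over i < j is
  the binomial coefficient.\<close>

lemma norm_gbinomial_le:
  fixes t :: complex
  assumes "cmod t \<le> real R"
  shows "cmod (t gchoose j) \<le> real ((R + j) choose j)"
proof -
  have "cmod (\<Prod>i=0..<j. t - of_nat i) \<le> fact j * real ((R + j) choose j)"
  proof (induction j)
    case (Suc j)
    have "cmod (t - of_nat j) \<le> cmod t + real j"
      using norm_triangle_ineq4[of t "of_nat j"] by simp
    also have "\<dots> \<le> real (Suc (R + j))" using assms by simp
    finally have "cmod (\<Prod>i=0..<Suc j. t - of_nat i)
        \<le> fact j * real ((R + j) choose j) * real (Suc (R + j))"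
      using Suc by (simp add: norm_mult mult_mono del: of_nat_Suc)
    also have "real ((R + j) choose j) * real (Suc (R + j)) = real (Suc j) * real ((R + Suc j) choose Suc j)"
      using Suc_times_binomial[of j "R + j"]
      by (metis add_Suc_right mult.commute of_nat_mult)
    then have "fact j * real ((R + j) choose j) * real (Suc (R + j)) = fact (Suc j) * real ((R + Suc j) choose Suc j)"
      by (simp add: mult.assoc del: of_nat_Suc binomial_Suc_Suc)
    finally show ?case .
  qed simp
  then have "fact j * cmod (t gchoose j) \<le> fact j * real ((R + j) choose j)"
    by (simp add: gbinomial_mult_fact[symmetric] norm_mult)
  then show ?thesis by simp
qed

text \<open>Newton interpolation with forward differences \<open>d\<close> at 0; at a natural number
  the series terminates.\<close>

definition newton_series :: "(nat \<Rightarrow> real) \<Rightarrow> complex \<Rightarrow> complex" where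
  "newton_series d t = (\<Sum>j. of_real (d j) * (t gchoose j))"

lemma newton_series_of_nat:
  "newton_series d (of_nat k) = of_real (\<Sum>j\<le>k. d j * real (k choose j))"
proof -
  have "newton_series d (of_nat k) = (\<Sum>j\<le>k. of_real (d j) * (of_nat k gchoose j))"
    unfolding newton_series_def
    by (rule suminf_finite) (auto simp: binomial_gbinomial[symmetric] not_le)
  then show ?thesis by (simp add: binomial_gbinomial[symmetric])
qed

context
  fixes d :: "nat \<Rightarrow> real" and C :: real
  assumes d: "\<And>j. \<bar>d j\<bar> \<le> C * (1 / 20) ^ j"
begin

text \<open>Taking x = 1/10 in \<open>binomial_power_le\<close> costs 10^j, which the decay 20^(-j)
  turns into 2^(-j). What remains is growth (10/9)^R, slow enough for the later zero count since
  (10/9)^6 < 2.\<close>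

lemma newton_series_term_le:
  assumes "cmod t \<le> real R"
  shows "cmod (of_real (d j) * (t gchoose j)) \<le> C * (10 / 9) ^ R * (1 / 2) ^ j"
proof -
  have C: "C \<ge> 0" using d[of 0] by simp
  have "real ((R + j) choose j) \<le> 10 ^ j * (10 / 9) ^ R"
    using binomial_power_le[of "1 / 10" R j] by (simp add: field_simps power_divide)
  then have "cmod (t gchoose j) \<le> 10 ^ j * (10 / 9) ^ R"
    using norm_gbinomial_le[OF assms, of j] by linarith
  then have "\<bar>d j\<bar> * cmod (t gchoose j) \<le> (C * (1 / 20) ^ j) * (10 ^ j * (10 / 9) ^ R)"
    using C by (intro mult_mono d) auto
  also have "\<dots> = C * (10 / 9) ^ R * ((1 / 20) * 10) ^ j"
    unfolding power_mult_distrib by simp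
  finally show ?thesis by (simp add: norm_mult)
qed

lemma newton_series_bound_sums: "(\<lambda>j. C * (10 / 9) ^ R * (1 / 2) ^ j) sums (2 * C * (10 / 9) ^ R)"
proof -
  have "(\<lambda>j. C * (10 / 9) ^ R * (1 / 2) ^ j) sums (C * (10 / 9) ^ R * (1 / (1 - 1 / 2)))"
    by (intro sums_mult geometric_sums) simp
  then show ?thesis by (simp add: mult_ac)
qed

lemma newton_series_summable: "summable (\<lambda>j. of_real (d j) * (t gchoose j :: complex))"
proof -
  obtain R :: nat where "cmod t \<le> real R" using real_arch_simple by blast
  from newton_series_term_le[OF this] show ?thesis
    by (rule summable_comparison_test'[OF sums_summable[OF newton_series_bound_sums]])
qed

lemma norm_newton_series_le:
  assumes "cmod t \<le> real R"
  shows "cmod (newton_series d t) \<le> 2 * C * (10 / 9) ^ R"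
  unfolding newton_series_def sums_unique[OF newton_series_bound_sums]
  by (rule norm_suminf_le[OF newton_series_term_le[OF assms] sums_summable[OF newton_series_bound_sums]])

lemma holomorphic_newton_series: "newton_series d holomorphic_on UNIV"
proof (rule holomorphic_uniform_sequence[where f = "\<lambda>n t. \<Sum>j<n. of_real (d j) * (t gchoose j)"])
  show "(\<lambda>t. \<Sum>j<n. of_real (d j) * (t gchoose j)) holomorphic_on UNIV" for n
    unfolding gbinomial_prod_rev by (intro holomorphic_intros) auto
  fix t :: complex
  obtain R :: nat where R: "cmod t + 1 \<le> real R" using real_arch_simple by blast
  have "uniform_limit (cball t 1) (\<lambda>n t. \<Sum>j<n. of_real (d j) * (t gchoose j))
      (\<lambda>t. \<Sum>j. of_real (d j) * (t gchoose j)) sequentially"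
  proof (rule Weierstrass_m_test)
    fix n s assume "s \<in> cball t 1"
    then have "cmod (t - s) \<le> 1" by (simp add: dist_norm)
    then have "cmod s \<le> real R" using R norm_triangle_ineq4[of t "t - s"] by simp
    then show "cmod (of_real (d n) * (s gchoose n)) \<le> C * (10 / 9) ^ R * (1 / 2) ^ n"
      by (rule newton_series_term_le)
  qed (rule sums_summable[OF newton_series_bound_sums])
  then show "\<exists>r. 0 < r \<and> cball t r \<subseteq> UNIV \<and>
      uniform_limit (cball t r) (\<lambda>n t. \<Sum>j<n. of_real (d j) * (t gchoose j)) (newton_series d) sequentially"
    unfolding newton_series_def[abs_def] by (intro exI[of _ 1]) auto
qed simp

text \<open>Real values on the real axis let sign changes produce genuine zeros.\<close>

lemma Im_newton_series: "Im (newton_series d (of_real u)) = 0"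
proof -
  have "of_real u gchoose j = complex_of_real (u gchoose j)" for j
    by (simp add: gbinomial_prod_rev)
  then have Im_term: "Im (of_real (d j) * (of_real u gchoose j)) = 0" for j by simp
  have "Im (newton_series d (of_real u)) = (\<Sum>j. Im (of_real (d j) * (of_real u gchoose j)))"
    unfolding newton_series_def by (rule bounded_linear.suminf[OF bounded_linear_Im newton_series_summable])
  then show ?thesis by (simp only: Im_term suminf_zero)
qed

end

section \<open>Too many zeros for slow growth\<close>

lemma factor_out_zeros:
  assumes "f holomorphic_on UNIV" "\<And>i. i < N \<Longrightarrow> f (\<zeta> i) = 0" "inj_on \<zeta> {..<N::nat}"
  shows "\<exists>q. q holomorphic_on UNIV \<and> (\<forall>z. f z = (\<Prod>i<N. z - \<zeta> i) * q z)"
  using assms(2,3)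
proof (induction N)
  case 0
  show ?case using assms(1) by (intro exI[of _ f]) auto
next
  case (Suc N)
  have "\<exists>q. q holomorphic_on UNIV \<and> (\<forall>z. f z = (\<Prod>i<N. z - \<zeta> i) * q z)"
    by (rule Suc.IH) (use Suc.prems in \<open>auto simp: inj_on_def\<close>)
  then obtain q where q: "q holomorphic_on UNIV" "\<And>z. f z = (\<Prod>i<N. z - \<zeta> i) * q z" by blast
  have "\<zeta> N - \<zeta> i \<noteq> 0" if "i < N" for i
    using inj_onD[OF Suc.prems(2), of N i] that by auto
  then have "(\<Prod>i<N. \<zeta> N - \<zeta> i) \<noteq> 0" by simp
  then have "q (\<zeta> N) = 0" using q(2)[of "\<zeta> N"] Suc.prems(1)[of N] by simp
  then obtain g where "g holomorphic_on UNIV" "\<And>z. q z = (z - \<zeta> N) * g z"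
    using entire_divide_zero[OF q(1)] by metis
  then show ?case using q(2) by (intro exI[of _ g]) (simp add: mult.assoc)
qed

lemma IVT_product:
  fixes r :: "real \<Rightarrow> real"
  assumes "r p * r q \<le> 0" "p \<le> q" "continuous_on {p..q} r"
  obtains u where "p \<le> u" "u \<le> q" "r u = 0"
  using assms IVT'[of r p 0 q] IVT2'[of r q 0 p] by (auto simp: mult_le_0_iff)

text \<open>A Jensen-type argument: N zeros within radius \<open>k0 + 2 * N\<close> gain a factor
  2^(-N) by the maximum principle, whereas the growth costs only a constant times
  ((10/9)^6)^N.\<close>

lemma newton_series_sign_changes_eq_0:
  fixes d :: "nat \<Rightarrow> real"
  defines "G \<equiv> \<lambda>k. \<Sum>j\<le>k. d j * real (k choose j)"
  assumes d: "\<And>j. \<bar>d j\<bar> \<le> C * (1 / 20) ^ j"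
    and sign: "\<And>k. k \<ge> k0 \<Longrightarrow> G k * G (Suc k) \<le> 0"
  shows "G k = 0"
proof -
  let ?g = "newton_series d"
  have hol: "?g holomorphic_on UNIV" by (rule holomorphic_newton_series[OF d])
  have gG: "?g (of_nat k) = of_real (G k)" for k unfolding G_def by (rule newton_series_of_nat)
  have C: "C \<ge> 0" using d[of 0] by simp
  have cont: "continuous_on S (\<lambda>u. Re (?g (of_real u)))" for S
    by (intro continuous_intros continuous_on_compose2[OF holomorphic_on_imp_continuous_on[OF hol]]) auto
  \<comment> \<open>Using every second interval keeps the intervals disjoint, so a zero at an
    integer is not counted twice.\<close>
  have "\<exists>u. real (k0 + 2 * i) \<le> u \<and> u \<le> real (k0 + 2 * i + 1) \<and> ?g (of_real u) = 0" for i
  proof -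
    let ?p = "k0 + 2 * i"
    have Gp: "Re (?g (of_real (real n))) = G n" for n using gG[of n] by simp
    have "G ?p * G (Suc ?p) \<le> 0" by (rule sign) simp
    then have "Re (?g (of_real (real ?p))) * Re (?g (of_real (real (Suc ?p)))) \<le> 0"
      unfolding Gp .
    then obtain u where u: "real ?p \<le> u" "u \<le> real (Suc ?p)" "Re (?g (of_real u)) = 0"
      by (rule IVT_product[OF _ _ cont]) auto
    moreover have "?g (of_real u) = 0" using u(3) Im_newton_series[OF d, of u] by (simp add: complex_eq_iff)
    ultimately show ?thesis by (intro exI[of _ u]) auto
  qed
  then obtain u where u: "\<And>i. real (k0 + 2 * i) \<le> u i" "\<And>i. u i \<le> real (k0 + 2 * i + 1)"
    "\<And>i. ?g (of_real (u i)) = 0" by metis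
  have u_less: "u i < u j" if "i < j" for i j
  proof -
    have "real (k0 + 2 * i + 1) < real (k0 + 2 * j)" using that by (simp del: of_nat_add of_nat_mult)
    then show ?thesis using u(1)[of j] u(2)[of i] by linarith
  qed
  have inj: "inj_on (\<lambda>i. complex_of_real (u i)) {..<N}" for N
    by (rule inj_onI) (metis less_irrefl linorder_neqE_nat of_real_eq_iff u_less)
  have bound: "\<bar>G k\<bar> \<le> 2 * C * (10 / 9) ^ (3 * k0) * ((10 / 9) ^ 6 / 2) ^ N" if "N \<ge> Suc k" for N
  proof -
    \<comment> \<open>\<open>L\<close> bounds both k and the first N zeros: each factor z - u_i is
      at least 2L in modulus on |z| = 3L and at most L at z = k.\<close>
    define L where "L = k0 + 2 * N"
    have L: "L \<ge> 1" "k \<le> L" using that by (auto simp: L_def)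
    have u0: "0 \<le> u i" "u i \<le> real L" if "i < N" for i
      using u(1)[of i] u(2)[of i] that by (auto simp: L_def)
    obtain q where q: "q holomorphic_on UNIV" "\<And>z. ?g z = (\<Prod>i<N. z - of_real (u i)) * q z"
      using factor_out_zeros[OF hol u(3) inj] by blast
    have "cmod (q (of_nat k)) \<le> 2 * C * (10 / 9) ^ (3 * L) / (2 * real L) ^ N"
    proof (rule entire_max_modulus[OF q(1)])
      fix z :: complex assume z: "cmod z = 3 * real L"
      have "2 * real L \<le> cmod (z - of_real (u i))" if "i < N" for i
        using norm_triangle_ineq2[of z "of_real (u i)"] z u0[OF that] by simp
      then have "(\<Prod>i<N. 2 * real L) \<le> (\<Prod>i<N. cmod (z - of_real (u i)))"
        by (intro prod_mono) auto
      then have "(2 * real L) ^ N * cmod (q z) \<le> (\<Prod>i<N. cmod (z - of_real (u i))) * cmod (q z)"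
        by (intro mult_right_mono) auto
      also have "\<dots> = cmod (?g z)" by (simp add: q(2)[of z] norm_mult prod_norm)
      also have "\<dots> \<le> 2 * C * (10 / 9) ^ (3 * L)"
        by (rule norm_newton_series_le[OF d]) (use z in simp)
      finally show "cmod (q z) \<le> 2 * C * (10 / 9) ^ (3 * L) / (2 * real L) ^ N"
        using L(1) by (simp add: field_simps)
    qed (use L in simp)
    moreover have "(\<Prod>i<N. cmod (of_nat k - of_real (u i))) \<le> real L ^ N"
    proof -
      have "cmod (of_nat k - of_real (u i)) \<le> real L" if "i < N" for i
      proof -
        have "cmod (of_nat k - of_real (u i)) = \<bar>real k - u i\<bar>"
          by (metis norm_of_real of_real_diff of_real_of_nat_eq)
        then show ?thesis using u0[OF that] L(2) by (simp add: abs_le_iff)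
      qed
      then have "(\<Prod>i<N. cmod (of_nat k - of_real (u i))) \<le> (\<Prod>i<N. real L)"
        by (intro prod_mono) auto
      then show ?thesis by simp
    qed
    ultimately have "cmod (?g (of_nat k)) \<le> real L ^ N * (2 * C * (10 / 9) ^ (3 * L) / (2 * real L) ^ N)"
      unfolding q(2)[of "of_nat k"] norm_mult prod_norm[symmetric]
      by (intro mult_mono) auto
    also have "\<dots> = 2 * C * (10 / 9) ^ (3 * L) / 2 ^ N"
      using L(1) by (simp add: power_mult_distrib)
    also have "(10 / 9 :: real) ^ (3 * L) = (10 / 9) ^ (3 * k0) * ((10 / 9) ^ 6) ^ N"
      by (simp only: power_mult[symmetric] power_add[symmetric] L_def)
        (simp add: algebra_simps)
    also have "2 * C * ((10 / 9) ^ (3 * k0) * ((10 / 9) ^ 6) ^ N) / 2 ^ N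
        = 2 * C * (10 / 9) ^ (3 * k0) * ((10 / 9) ^ 6 / 2) ^ N"
      by (simp only: power_divide[of _ 2] mult.assoc times_divide_eq_right)
    finally show ?thesis by (simp only: gG norm_of_real)
  qed
  have "(\<lambda>N. 2 * C * (10 / 9) ^ (3 * k0) * ((10 / 9) ^ 6 / 2) ^ N) \<longlonglongrightarrow> 2 * C * (10 / 9) ^ (3 * k0) * 0"
    by (intro tendsto_mult tendsto_const LIMSEQ_power_zero) (simp add: power_divide)
  then have "\<bar>G k\<bar> \<le> 2 * C * (10 / 9) ^ (3 * k0) * 0"
    by (rule LIMSEQ_le_const) (use bound in blast)
  then show ?thesis by simp
qed

section \<open>From power series coefficients to a Newton series\<close>

lemma higher_deriv_exp_linear:
  "(deriv ^^ n) (\<lambda>w. exp (c * w)) = (\<lambda>w. c ^ n * exp (c * w :: complex))"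
proof (induction n)
  case (Suc n)
  have "deriv (\<lambda>w. c ^ n * exp (c * w)) = (\<lambda>w. c ^ Suc n * exp (c * w))"
    by (intro ext DERIV_imp_deriv) (auto intro!: derivative_eq_intros)
  then show ?case by (simp add: Suc.IH)
qed simp

text \<open>The Leibniz rule for g = h exp (A w) writes k! b_k / A^k as the sum of d_j (k choose j).
  Dividing by powers of A > 0 preserves the signs, and exponential type 0 of h makes d_j decay
  fast.\<close>

lemma sign_changes_exponential_growth_eq_0:
  fixes b :: "nat \<Rightarrow> real"
  assumes entire: "\<And>w::complex. summable (\<lambda>k. of_real (b k) * w ^ k)" and "A > 0"
    and min: "\<And>\<epsilon>. \<epsilon> > 0 \<Longrightarrow> \<exists>C>0. \<forall>w. cmod w \<ge> 1 \<longrightarrow>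
      cmod ((\<Sum>k. of_real (b k) * w ^ k) * exp (- of_real A * w)) \<le> C * exp (\<epsilon> * cmod w)"
    and sign: "\<And>k. k \<ge> k0 \<Longrightarrow> b k * b (Suc k) \<le> 0"
  shows "b k = 0"
proof -
  define g where "g = (\<lambda>w::complex. \<Sum>k. of_real (b k) * w ^ k)"
  define h where "h = (\<lambda>w. g w * exp (- of_real A * w))"
  define c where "c j = (deriv ^^ j) h 0" for j
  \<comment> \<open>As b and A are real, taking real parts in the Leibniz formula avoids showing
    that \<open>c j\<close> is real.\<close>
  define d where "d j = Re (c j) / A ^ j" for j
  have holg: "g holomorphic_on UNIV"
    unfolding g_def by (rule holomorphic_entire_power_series[OF entire])
  have holh: "h holomorphic_on UNIV" unfolding h_def by (intro holomorphic_intros holg)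
  have gh: "g = (\<lambda>w. h w * exp (of_real A * w))"
    by (simp add: h_def fun_eq_iff exp_minus)
  have dg: "(deriv ^^ k) g 0 = fact k * of_real (b k)" for k
    unfolding g_def by (rule higher_deriv_entire_power_series[OF entire])
  have G: "(\<Sum>j\<le>k. d j * real (k choose j)) = fact k * b k / A ^ k" for k
  proof -
    have "fact k * of_real (b k) = (\<Sum>j=0..k. of_nat (k choose j) * c j * of_real A ^ (k - j))"
      unfolding dg[symmetric] unfolding gh c_def
      by (subst higher_deriv_mult[OF holh]) (auto intro!: holomorphic_intros simp: higher_deriv_exp_linear)
    then have "Re (fact k * of_real (b k)) = (\<Sum>j=0..k. Re (of_nat (k choose j) * c j * of_real A ^ (k - j)))"
      by simp
    then have "fact k * b k = (\<Sum>j\<le>k. real (k choose j) * Re (c j) * A ^ (k - j))"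
      by (simp add: of_real_power[symmetric] atMost_atLeast0 del: of_real_power)
    then have "fact k * b k / A ^ k = (\<Sum>j\<le>k. real (k choose j) * Re (c j) * A ^ (k - j) / A ^ k)"
      by (simp add: sum_divide_distrib)
    also have "\<dots> = (\<Sum>j\<le>k. d j * real (k choose j))"
      using \<open>A > 0\<close> by (intro sum.cong) (auto simp: d_def power_diff)
    finally show ?thesis by simp
  qed
  \<comment> \<open>The bound e epsilon / A <= 1/20 yields the decay required of \<open>d\<close>;
    epsilon <= 1 keeps the Cauchy radius j/epsilon in the region |w| >= 1 where growth is
    controlled.\<close>
  define \<epsilon> where "\<epsilon> = min 1 (A / (20 * exp 1))"
  have \<epsilon>: "\<epsilon> > 0" "\<epsilon> \<le> 1" "exp 1 * \<epsilon> / A \<le> 1 / 20"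
    using \<open>A > 0\<close> by (auto simp: \<epsilon>_def min_def field_simps)
  obtain C where C: "C > 0" "\<And>w. cmod w \<ge> 1 \<Longrightarrow> cmod (h w) \<le> C * exp (\<epsilon> * cmod w)"
    using min[OF \<epsilon>(1)] unfolding h_def g_def by blast
  have dle: "\<bar>d j\<bar> \<le> C * exp 1 * (1 / 20) ^ j" for j
  proof -
    have "cmod (c j) \<le> C * exp 1 * (exp 1 * \<epsilon>) ^ j"
    proof (cases "j = 0")
      case True
      have "cmod (h 0) \<le> C * exp 1"
      proof (rule entire_max_modulus[OF holh, where R = 1])
        fix w :: complex assume "cmod w = 1"
        then have "cmod (h w) \<le> C * exp \<epsilon>" using C(2)[of w] by simp
        also have "\<dots> \<le> C * exp 1" using C(1) \<epsilon>(2) by (intro mult_left_mono) auto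
        finally show "cmod (h w) \<le> C * exp 1" .
      qed simp
      then show ?thesis using True by (simp add: c_def)
    next
      case False
      \<comment> \<open>This radius minimizes exp (epsilon r) / r^j; with j! <= j^j the powers of j
        cancel.\<close>
      define r where "r = real j / \<epsilon>"
      have r: "r \<ge> 1" using False \<epsilon> by (simp add: r_def field_simps)
      have "cmod (c j) \<le> fact j * (C * exp (real j)) / r ^ j"
        unfolding c_def
      proof (rule entire_Cauchy_inequality[OF holh])
        fix w assume "cmod w = r"
        then show "cmod (h w) \<le> C * exp (real j)" using C(2)[of w] r \<epsilon>(1) by (simp add: r_def)
      qed (use r in simp)
      also have "\<dots> \<le> real j ^ j * (C * exp (real j)) / r ^ j"
        using fact_le_power[of j, where 'a = real] C(1) r
        by (intro divide_right_mono mult_right_mono) auto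
      also have "\<dots> = C * (exp 1 * \<epsilon>) ^ j"
        using False \<epsilon>(1) by (simp add: r_def power_divide power_mult_distrib exp_of_nat_mult[symmetric])
      also have "\<dots> \<le> C * exp 1 * (exp 1 * \<epsilon>) ^ j"
        using C(1) \<epsilon>(1) by (intro mult_right_mono) auto
      finally show ?thesis .
    qed
    then have "\<bar>d j\<bar> \<le> C * exp 1 * (exp 1 * \<epsilon>) ^ j / A ^ j"
      using abs_Re_le_cmod[of "c j"] \<open>A > 0\<close> by (auto simp: d_def abs_divide intro!: divide_right_mono)
    also have "\<dots> = C * exp 1 * (exp 1 * \<epsilon> / A) ^ j" by (simp add: power_divide)
    also have "\<dots> \<le> C * exp 1 * (1 / 20) ^ j"
      using C(1) \<epsilon> \<open>A > 0\<close> by (intro mult_left_mono power_mono) auto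
    finally show ?thesis .
  qed
  have "fact k * b k / A ^ k = 0"
    unfolding G[symmetric]
  proof (rule newton_series_sign_changes_eq_0[OF dle])
    fix k assume "k0 \<le> k"
    have nonneg: "fact k * fact (Suc k) / (A ^ k * A ^ Suc k) \<ge> 0" using \<open>A > 0\<close> by simp
    have "p * u / q * (p' * v / q') = p * p' / (q * q') * (u * v)" for p q u p' q' v :: real
      by simp
    note eq = this[of "fact k" "b k" "A ^ k" "fact (Suc k)" "b (Suc k)" "A ^ Suc k"]
    show "(\<Sum>j\<le>k. d j * real (k choose j)) * (\<Sum>j\<le>Suc k. d j * real (Suc k choose j)) \<le> 0"
      unfolding G eq by (rule mult_nonneg_nonpos[OF nonneg sign[OF \<open>k0 \<le> k\<close>]])
  qed
  then show ?thesis using \<open>A > 0\<close> by simp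
qed

section \<open>The Gaussian parameter\<close>

lemma summable_power_series_arith_progression:
  fixes a :: "nat \<Rightarrow> real"
  assumes entire: "\<And>z::complex. summable (\<lambda>n. of_real (a n) * z ^ n)"
  shows "summable (\<lambda>k. of_real (a (2 * k + s)) * (w::complex) ^ k)"
proof -
  \<comment> \<open>As rho >= 1, |w|^k <= rho^(2k + s), so a subseries of the absolutely convergent
    series at rho dominates.\<close>
  define \<rho> where "\<rho> = 1 + cmod w"
  have \<rho>: "\<rho> \<ge> 1" "cmod w \<le> \<rho>" by (simp_all add: \<rho>_def)
  have "summable (\<lambda>n. norm (of_real (a n) * (of_real \<rho> :: complex) ^ n))"
    by (rule powser_insidea[OF entire[of "of_real (\<rho> + 1)"]]) (use \<rho> in \<open>simp del: of_real_add\<close>)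
  then have "summable (\<lambda>n. \<bar>a n\<bar> * \<rho> ^ n)" using \<rho> by (simp add: norm_mult norm_power)
  then have "summable ((\<lambda>n. \<bar>a n\<bar> * \<rho> ^ n) \<circ> (\<lambda>k. 2 * k + s))"
    by (rule summable_reindex) (use \<rho> in \<open>auto simp: inj_on_def\<close>)
  then have summ: "summable (\<lambda>k. \<bar>a (2 * k + s)\<bar> * \<rho> ^ (2 * k + s))" by (simp only: o_def)
  have "norm (of_real (a (2 * k + s)) * w ^ k) \<le> \<bar>a (2 * k + s)\<bar> * \<rho> ^ (2 * k + s)" for k
  proof -
    have "cmod w ^ k \<le> \<rho> ^ k" using \<rho> by (intro power_mono) auto
    also have "\<dots> \<le> \<rho> ^ (2 * k + s)" using \<rho> by (intro power_increasing) auto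
    finally show ?thesis by (simp add: norm_mult norm_power mult_left_mono)
  qed
  then show ?thesis by (rule summable_comparison_test'[OF summ])
qed

lemma power_series_even_odd:
  fixes a :: "nat \<Rightarrow> real" and z :: complex
  assumes entire: "\<And>z::complex. summable (\<lambda>n. of_real (a n) * z ^ n)"
  shows "(\<Sum>n. of_real (a n) * z ^ n) =
    (\<Sum>k. of_real (a (2 * k)) * (z\<^sup>2) ^ k) + z * (\<Sum>k. of_real (a (2 * k + 1)) * (z\<^sup>2) ^ k)"
proof -
  have groups: "(\<lambda>k. \<Sum>n\<in>{k * 2..<k * 2 + 2}. of_real (a n) * z ^ n) sums (\<Sum>n. of_real (a n) * z ^ n)"
    by (rule sums_group[OF summable_sums[OF entire]]) simp
  have group: "(\<Sum>n\<in>{k * 2..<k * 2 + 2}. of_real (a n) * z ^ n) =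
      of_real (a (2 * k)) * (z\<^sup>2) ^ k + z * (of_real (a (2 * k + 1)) * (z\<^sup>2) ^ k)" for k
  proof -
    have "{k * 2..<k * 2 + 2} = {2 * k, 2 * k + 1}" by auto
    then show ?thesis by (simp add: power_mult)
  qed
  have "(\<lambda>k. of_real (a (2 * k)) * (z\<^sup>2) ^ k + z * (of_real (a (2 * k + 1)) * (z\<^sup>2) ^ k)) sums
    ((\<Sum>k. of_real (a (2 * k)) * (z\<^sup>2) ^ k) + z * (\<Sum>k. of_real (a (2 * k + 1)) * (z\<^sup>2) ^ k))"
    using summable_power_series_arith_progression[OF entire, of 0]
      summable_power_series_arith_progression[OF entire, of 1]
    by (intro sums_add sums_mult summable_sums) simp_all
  then show ?thesis by (rule sums_unique2[OF groups[unfolded group]])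
qed

text \<open>The indices n - 1 and n + 1 have equal parity, so in w = z^2 the sign condition concerns
  consecutive coefficients of the even part and of the odd part.\<close>

lemma no_positive_gaussian_factor:
  fixes a :: "nat \<Rightarrow> real"
  assumes entire: "\<And>z::complex. summable (\<lambda>n. of_real (a n) * z ^ n)" and A: "A > 0"
    and sign: "\<And>n. n > n0 \<Longrightarrow> a (n - 1) * a (n + 1) \<le> 0"
    and min: "\<And>\<epsilon>. \<epsilon> > 0 \<Longrightarrow> \<exists>C>0. \<forall>z::complex.
      cmod ((\<Sum>n. of_real (a n) * z ^ n) * exp (- of_real A * z\<^sup>2)) \<le> C * exp (\<epsilon> * (cmod z)\<^sup>2)"
  shows "a n = 0"
proof -
  define \<phi> where "\<phi> = (\<lambda>z::complex. \<Sum>n. of_real (a n) * z ^ n)"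
  define g where "g s w = (\<Sum>k. of_real (a (2 * k + s)) * (w::complex) ^ k)" for s w
  have split: "\<phi> z = g 0 (z\<^sup>2) + z * g 1 (z\<^sup>2)" for z
    unfolding \<phi>_def g_def using power_series_even_odd[OF entire, of z] by simp
  have parity: "a (2 * k + s) = 0" if s: "s = 0 \<or> s = 1" for s k
  proof (rule sign_changes_exponential_growth_eq_0[OF summable_power_series_arith_progression[OF entire] A])
    fix \<epsilon> :: real assume "\<epsilon> > 0"
    from min[OF this] obtain C where C: "C > 0"
      "\<And>z. cmod (\<phi> z * exp (- of_real A * z\<^sup>2)) \<le> C * exp (\<epsilon> * (cmod z)\<^sup>2)" unfolding \<phi>_def by blast
    have "cmod (g s w * exp (- of_real A * w)) \<le> C * exp (\<epsilon> * cmod w)" if w: "cmod w \<ge> 1" for w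
    proof -
      define z where "z = csqrt w"
      have zw: "z\<^sup>2 = w" by (simp add: z_def)
      then have z2: "(cmod z)\<^sup>2 = cmod w" by (metis norm_power)
      \<comment> \<open>The odd part is recovered as (phi z - phi (-z)) / (2z), and dividing by z is
        harmless only away from 0. This is why growth in w is stated for |w| >= 1.\<close>
      have "cmod z \<ge> 1" using w z2 by (metis norm_ge_zero one_power2 power2_le_imp_le)
      have "2 * cmod (g s w) \<le> cmod (\<phi> z) + cmod (\<phi> (- z))"
      proof (cases "s = 0")
        case True
        have "2 * g 0 w = \<phi> z + \<phi> (- z)" using split[of z] split[of "- z"] by (simp add: zw)
        then show ?thesis using True
          by (metis norm_mult norm_numeral norm_triangle_ineq)
      next
        case False
        have "2 * z * g 1 w = \<phi> z - \<phi> (- z)" using split[of z] split[of "- z"] by (simp add: zw)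
        then have "2 * cmod z * cmod (g 1 w) \<le> cmod (\<phi> z) + cmod (\<phi> (- z))"
          by (metis norm_mult norm_numeral norm_triangle_ineq4)
        moreover have "2 * cmod (g 1 w) * 1 \<le> 2 * cmod (g 1 w) * cmod z"
          using \<open>cmod z \<ge> 1\<close> by (intro mult_left_mono) auto
        ultimately show ?thesis using False s by (simp add: mult_ac)
      qed
      then have "2 * cmod (g s w) * cmod (exp (- of_real A * w)) \<le>
          (cmod (\<phi> z) + cmod (\<phi> (- z))) * cmod (exp (- of_real A * w))"
        by (intro mult_right_mono) auto
      also have "\<dots> = cmod (\<phi> z * exp (- of_real A * z\<^sup>2)) + cmod (\<phi> (- z) * exp (- of_real A * (- z)\<^sup>2))"
        by (simp add: norm_mult zw distrib_right)
      also have "\<dots> \<le> 2 * (C * exp (\<epsilon> * cmod w))"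
        using C(2)[of z] C(2)[of "- z"] by (simp add: z2)
      finally show ?thesis by (simp add: norm_mult)
    qed
    then show "\<exists>C>0. \<forall>w. 1 \<le> cmod w \<longrightarrow>
        cmod ((\<Sum>k. of_real (a (2 * k + s)) * w ^ k) * exp (- of_real A * w)) \<le> C * exp (\<epsilon> * cmod w)"
      using C(1) unfolding g_def by blast
  next
    fix k assume "k \<ge> n0"
    then show "a (2 * k + s) * a (2 * Suc k + s) \<le> 0" using sign[of "2 * k + s + 1"] by simp
  qed
  have "n mod 2 = 0 \<or> n mod 2 = 1" by presburger
  from parity[OF this, of "n div 2"] show ?thesis by simp
qed

text \<open>Entries x k = 0 contribute the factor 1 and are dropped from the index set, which
  \<open>initial\<close> makes an initial segment or everything. The representation takes lam =
  1.\<close>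

lemma LP_repr_of_zero_sequence:
  assumes initial: "\<And>k n. k \<le> n \<Longrightarrow> x n \<noteq> 0 \<Longrightarrow> x k \<noteq> 0"
    and summ: "summable (\<lambda>k. 1 / (x k)\<^sup>2)"
    and lim: "\<And>z. (\<lambda>n. of_real c * z ^ m * exp (of_real A * z\<^sup>2 + of_real b * z) *
        (\<Prod>k<n. (1 - z / of_real (x k)) * exp (z / of_real (x k)))) \<longlonglongrightarrow> \<phi> z"
  shows "LP_repr \<phi> A"
proof -
  define I where "I = {k. x k \<noteq> 0}"
  have I: "I = UNIV \<or> (\<exists>N. I = {..<N})"
  proof (cases "\<exists>k. x k = 0")
    case True
    define N where "N = (LEAST k. x k = 0)"
    have "x N = 0" using LeastI_ex[OF True] by (simp add: N_def)
    then have "I = {..<N}"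
      using initial not_less_Least[of _ "\<lambda>k. x k = 0"] by (auto simp: I_def N_def[symmetric] not_le[symmetric])
    then show ?thesis by blast
  qed (auto simp: I_def)
  have "(\<lambda>k. 1 / (x k)\<^sup>2) summable_on UNIV"
    by (rule norm_summable_imp_summable_on) (use summ in simp)
  then have "(\<lambda>k. 1 / (x k)\<^sup>2) summable_on I" by (rule summable_on_subset_banach) simp
  moreover have "\<bar>x k\<bar> powr (- 1 - 1) = 1 / (x k)\<^sup>2" if "k \<in> I" for k
    using that powr_realpow[of "\<bar>x k\<bar>" 2] by (simp add: I_def powr_minus_divide)
  ultimately have summ_I: "(\<lambda>k. \<bar>x k\<bar> powr (- 1 - 1)) summable_on I"
    using summable_on_cong[of I "\<lambda>k. \<bar>x k\<bar> powr (- 1 - 1)" "\<lambda>k. 1 / (x k)\<^sup>2"] by blast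
  have prod_eq: "(\<Prod>k\<in>I \<inter> {..<n}. (1 - z / of_real (x k)) * exp (of_real 1 * z / of_real (x k))) =
      (\<Prod>k<n. (1 - z / of_real (x k)) * exp (z / of_real (x k)))" for n and z :: complex
    by (rule prod.mono_neutral_cong_left) (auto simp: I_def)
  show ?thesis
    unfolding LP_repr_def
  proof (rule exI[of _ c], rule exI[of _ m], rule exI[of _ b], rule exI[of _ 1], rule exI[of _ x],
      rule exI[of _ I], intro conjI allI ballI)
    show "I = UNIV \<or> (\<exists>N. I = {..<N})" by (rule I)
    show "(\<lambda>k. \<bar>x k\<bar> powr (- 1 - 1)) summable_on I" by (rule summ_I)
    show "x k \<noteq> 0" if "k \<in> I" for k using that by (simp add: I_def)
    show "(\<lambda>n. of_real c * z ^ m * exp (of_real A * z\<^sup>2 + of_real b * z) *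
        (\<Prod>k\<in>I \<inter> {..<n}. (1 - z / of_real (x k)) * exp (of_real 1 * z / of_real (x k)))) \<longlonglongrightarrow> \<phi> z" for z
      unfolding prod_eq by (rule lim)
  qed simp
qed

theorem theorem1:
  fixes a :: "nat \<Rightarrow> real" and n0 :: nat
  assumes entire: "\<And>z::complex. summable (\<lambda>n. of_real (a n) * z ^ n)"
    and real_zeros: "\<And>z::complex. (\<Sum>n. of_real (a n) * z ^ n) = 0 \<Longrightarrow> Im z = 0"
    and sign: "\<And>n. n > n0 \<Longrightarrow> a (n - 1) * a (n + 1) \<le> 0"
    and lim_pos: "0 < limsup (\<lambda>n. ereal (real n * \<bar>a n\<bar> powr (2 / real n)))"
    and lim_fin: "limsup (\<lambda>n. ereal (real n * \<bar>a n\<bar> powr (2 / real n))) < \<infinity>"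
  shows "LPa (\<lambda>z. \<Sum>n. of_real (a n) * z ^ n)"
proof -
  define \<phi> where "\<phi> = (\<lambda>z::complex. \<Sum>n. of_real (a n) * z ^ n)"
  \<comment> \<open>The zero function is excluded because it would vanish at the non-real point
    \<open>\<i>\<close>.\<close>
  have "\<exists>m. a m \<noteq> 0"
  proof (rule ccontr)
    assume "\<not> ?thesis"
    then show False using real_zeros[of \<i>] by simp
  qed
  define m where "m = (LEAST m. a m \<noteq> 0)"
  have am: "a m \<noteq> 0" using LeastI_ex[OF \<open>\<exists>m. a m \<noteq> 0\<close>] by (simp add: m_def)
  have below_m: "a i = 0" if "i < m" for i using not_less_Least that by (auto simp: m_def)
  define f where "f = (\<lambda>z::complex. \<Sum>n. of_real (a (n + m)) * z ^ n)"
  have entire_f: "summable (\<lambda>n. of_real (a (n + m)) * z ^ n)" for z :: complex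
    using entire[of z] summable_powser_ignore_initial_segment[of "\<lambda>n. of_real (a n)" m z] by simp
  have \<phi>f: "\<phi> z = z ^ m * f z" for z
  proof -
    have "\<phi> z = (\<Sum>n. of_real (a (n + m)) * z ^ (n + m))"
      unfolding \<phi>_def using suminf_split_initial_segment[OF entire, of z m] below_m by simp
    also have "\<dots> = (\<Sum>n. z ^ m * (of_real (a (n + m)) * z ^ n))"
      by (simp add: power_add mult_ac)
    also have "\<dots> = z ^ m * f z" unfolding f_def by (rule suminf_mult[OF entire_f])
    finally show ?thesis .
  qed
  have hol_f: "f holomorphic_on UNIV"
    unfolding f_def by (rule holomorphic_entire_power_series[OF entire_f])
  have deriv_f: "(deriv ^^ n) f 0 = fact n * of_real (a (n + m))" for n
    unfolding f_def by (rule higher_deriv_entire_power_series[OF entire_f])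
  have f0: "f 0 = of_real (a m)" using deriv_f[of 0] by simp
  have "deriv f 0 = of_real (a (1 + m))" using deriv_f[of 1] by simp
  then have ld1: "log_deriv1 f = of_real (a (1 + m) / a m)" by (simp add: log_deriv1_def f0)
  have "deriv (deriv f) 0 = of_real (2 * a (2 + m))" using deriv_f[of 2] by (simp add: numeral_2_eq_2)
  with \<open>deriv f 0 = of_real (a (1 + m))\<close>
  have ld2: "log_deriv2 f = of_real ((2 * a (2 + m) * a m - (a (1 + m))\<^sup>2) / (a m)\<^sup>2)"
    by (simp add: log_deriv2_def f0)
  obtain C B where CB: "B \<ge> 0" "\<And>z. cmod (\<phi> z) \<le> C * exp (B * (cmod z)\<^sup>2)"
    using growth_of_limsup[OF lim_fin] unfolding \<phi>_def by blast
  have growth: "cmod (f z) \<le> C * exp (B * (cmod z)\<^sup>2)" if "cmod z \<ge> 1" for z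
  proof -
    have "1 * cmod (f z) \<le> cmod z ^ m * cmod (f z)"
      using that by (intro mult_right_mono one_le_power) auto
    also have "\<dots> = cmod (\<phi> z)" by (simp add: \<phi>f norm_mult norm_power)
    finally show ?thesis using CB(2)[of z] by simp
  qed
  have f_nz: "f 0 \<noteq> 0" using am f0 by simp
  have real_zeros_f: "Im z = 0" if "f z = 0" for z
    using real_zeros[of z] \<phi>f[of z] that by (simp add: \<phi>_def)
  obtain x where x: "\<And>k n. k \<le> n \<Longrightarrow> x n \<noteq> 0 \<Longrightarrow> x k \<noteq> 0" "summable (\<lambda>k. 1 / (x k)\<^sup>2)"
    "\<And>z. (\<lambda>n. f 0 * exp (log_deriv1 f * z + (log_deriv2 f + of_real (\<Sum>k. 1 / (x k)\<^sup>2)) / 2 * z\<^sup>2)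
        * (\<Prod>k<n. (1 - z / of_real (x k)) * exp (z / of_real (x k)))) \<longlonglongrightarrow> f z"
    using real_zeros_factorization[OF hol_f f_nz real_zeros_f growth CB(1)] by blast
  define b where "b = a (1 + m) / a m"
  \<comment> \<open>The quadratic coefficient of the limiting exponent; it is real because the
    Taylor coefficients and the zeros are.\<close>
  define A where "A = ((2 * a (2 + m) * a m - (a (1 + m))\<^sup>2) / (a m)\<^sup>2 + (\<Sum>k. 1 / (x k)\<^sup>2)) / 2"
  have lim: "(\<lambda>n. of_real (a m) * z ^ m * exp (of_real A * z\<^sup>2 + of_real b * z) *
        (\<Prod>k<n. (1 - z / of_real (x k)) * exp (z / of_real (x k)))) \<longlonglongrightarrow> \<phi> z" for z
  proof -
    have "(log_deriv2 f + of_real (\<Sum>k. 1 / (x k)\<^sup>2)) / 2 = of_real A" by (simp add: ld2 A_def)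
    then have "(\<lambda>n. z ^ m * (of_real (a m) * exp (of_real b * z + of_real A * z\<^sup>2)
        * (\<Prod>k<n. (1 - z / of_real (x k)) * exp (z / of_real (x k))))) \<longlonglongrightarrow> \<phi> z"
      unfolding \<phi>f using tendsto_mult_left[OF x(3)[of z], of "z ^ m"] by (simp only: f0 ld1 b_def)
    then show ?thesis by (simp only: mult_ac add.commute)
  qed
  have min: "\<exists>C>0. \<forall>z. cmod (\<phi> z * exp (- of_real A * z\<^sup>2)) \<le> C * exp (\<epsilon> * (cmod z)\<^sup>2)" if "\<epsilon> > 0" for \<epsilon>
    by (rule minimal_type_of_factorization[OF x(2) that lim])
  \<comment> \<open>For A = 0 the minimal type bound would hold for \<open>\<phi>\<close> itself,
    against the positive limsup.\<close>
  have "A \<noteq> 0"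
  proof
    assume "A = 0"
    then have "limsup (\<lambda>n. ereal (real n * \<bar>a n\<bar> powr (2 / real n))) \<le> 0"
      using min by (intro limsup_le_of_minimal_type[OF entire]) (simp add: \<phi>_def)
    then show False using lim_pos by simp
  qed
  \<comment> \<open>A positive A would force every coefficient to vanish, including
    \<open>a m\<close>.\<close>
  moreover have "\<not> A > 0"
    using no_positive_gaussian_factor[OF entire _ sign min[unfolded \<phi>_def]] am by blast
  moreover have "LP_repr \<phi> A" by (rule LP_repr_of_zero_sequence[OF x(1,2) lim])
  ultimately show ?thesis unfolding LPa_def \<phi>_def by (meson linorder_neqE_linordered_idom)
qed

end
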